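(* Let $K$ be an even-dimensional compact connected Lie group, let $(K,\gamma;\mathbb J_\pm,\sigma)$ be a Lie algebraic generalized Kähler structure and let $\mathfrak L_\pm\subset\mathfrak d$ be the complex Lagrangian subalgebra defining $\mathbb J_\pm$. Then there exist two (not necessarily distinct) Samelson subalgebras $\mathfrak l_\pm\subset\mathfrak g$ such that $\mathfrak L_+=\mathfrak l_-\boxplus\mathfrak l_+$ and $\mathfrak L_-=\bar{\mathfrak l}_-\boxplus\mathfrak l_+$.
   Context: Generalized geometry. For a manifold $M$ with closed $\gamma\in\Omega^3(M)$, $\mathbb TM=TM\oplus T^*M$ carries the pairing $\langle X+\xi,Y+\eta\rangle=\frac12(\iota_X\eta+\iota_Y\xi)$ and the Dorfman bracket $(X+\xi)*(Y+\eta)=[X,Y]+\mathcal L_X\eta-\iota_Yd\xi+\iota_X\iota_Y\gamma$. A generalized complex structure is an orthogonal $\mathbb J:\mathbb TM\to\mathbb TM$ with $\mathbb J^2=-1$ whose $i$-eigenbundle $L\subset\mathbb TM\otimes\mathbb C$ is closed under $*$. A generalized Kähler structure $(M,\gamma;\mathbb J_\pm,g)$ is a pair of commuting generalized complex structures with $-\mathbb J_+\mathbb J_-=\begin{pmatrix}0&g^{-1}\\ g&0\end{pmatrix}$, $g$ a Riemannian metric. Lie group setting. $\dim K=2n$, $\mathfrak k$ is the Lie algebra of $K$, $\mathfrak g=\mathfrak k\otimes\mathbb C$ with complex conjugation $\bar{\ }$ relative to $\mathfrak k$, identified with right invariant vector fields (so $[X_a^r,X_b^r]=X^r_{[a,b]}$);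 $X_a^r$, $X_a^l$ are the right, left invariant vector fields with value $a$ at the identity and $\theta^r,\theta^l$ the right, left invariant $\mathfrak g$-valued Cartan 1-forms. $\kappa$ is the invariant symmetric bilinear form on $\mathfrak g$ given by $-\mathrm{tr}(\mathrm{ad}_a\mathrm{ad}_b)$ on $[\mathfrak g,\mathfrak g]$, extended so that $\mathfrak g=[\mathfrak g,\mathfrak g]\oplus\mathfrak z$ ($\mathfrak z$ the center) is orthogonal and $\sigma(X_a^r,X_b^r)=\kappa(a,b)$ is a bi-invariant Riemannian metric on $K$; $\gamma(X_a^r,X_b^r,X_c^r)=\kappa(a,[b,c])$. Let $\mathfrak d=\mathfrak g\oplus\mathfrak g$ with quadratic form $-\kappa\oplus\kappa$; the Courant trivialization sends $\hat a=(a,a')\in\mathfrak d$ to $\mathfrak X_{\hat a}=X_{a'}^r-X_a^l+\kappa(\theta^r,a')+\kappa(\theta^l,a)$. A Lie algebraic generalized complex structure on $K$ is one whose $i$-eigenbundle is spanned by $\{\mathfrak X_{\hat a}:\hat a\in\mathfrak L\}$ for a complex Lagrangian subalgebra $\mathfrak L\subset\mathfrak d$ with $\mathfrak L\cap(\mathfrak k\oplus\mathfrak k)=\{0\}$ (then $\mathfrak L$ is said to define it). A generalized Kähler structure $(K,\gamma;\mathbb J_\pm,\sigma)$ is Lie algebraic if both $\mathbb J_\pm$ are. A Samelson subalgebra is a complex Lie subalgebra $\mathfrak l\subset\mathfrak g$ of complex dimension $n$ with $\mathfrak l\cap\mathfrak k=\{0\}$; it is the $i$-eigenspace of an integrable complex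 structure on $\mathfrak k$, which is assumed orthogonal with respect to $\kappa$, so that $\mathfrak l$ is $\kappa$-isotropic. The notation $\mathfrak l\boxplus\mathfrak l'$ means $\{(a,a'):a\in\mathfrak l,a'\in\mathfrak l'\}\subset\mathfrak g\oplus\mathfrak g=\mathfrak d$. *)

theory Defs
  imports "HOL-Analysis.Analysis" "HOL-Library.Function_Algebras"
begin

section \<open>Linear algebra\<close>

text \<open>Functions into a real vector space, with pointwise operations (addition comes from
  \<open>Function_Algebras\<close>). Tangent vectors and covectors below are such functions.\<close>

instantiation "fun" :: (type, real_vector) real_vector
begin

definition scaleR_fun :: "real \<Rightarrow> ('a \<Rightarrow> 'b) \<Rightarrow> 'a \<Rightarrow> 'b" where
  "scaleR_fun c f = (\<lambda>x. c *\<^sub>R f x)"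

instance
  by standard
    (simp_all add: scaleR_fun_def fun_eq_iff scaleR_add_right scaleR_add_left)

end

definition linear_on :: "'a::real_vector set \<Rightarrow> ('a \<Rightarrow> 'b::real_vector) \<Rightarrow> bool" where
  "linear_on V f \<longleftrightarrow> (\<forall>u\<in>V. \<forall>v\<in>V. f (u + v) = f u + f v)
     \<and> (\<forall>c. \<forall>u\<in>V. f (c *\<^sub>R u) = c *\<^sub>R f u)"

definition bilinear_on :: "'a::real_vector set \<Rightarrow> ('a \<Rightarrow> 'a \<Rightarrow> 'b::real_vector) \<Rightarrow> bool" where
  "bilinear_on V B \<longleftrightarrow> (\<forall>u\<in>V. linear_on V (B u)) \<and> (\<forall>v\<in>V. linear_on V (\<lambda>u. B u v))"


subsection \<open>Complexification\<close>

text \<open>\<open>Cplx u v\<close> stands for \<open>u + i v\<close> in \<open>V \<otimes> C\<close>, with \<open>u\<close>, \<open>v\<close> in the real space \<open>V\<close>.\<close>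

datatype 'a cplx = Cplx (re: 'a) (im: 'a)

instantiation cplx :: (ab_group_add) ab_group_add
begin

definition "0 = Cplx 0 0"
definition "x + y = Cplx (re x + re y) (im x + im y)"
definition "- x = Cplx (- re x) (- im x)"
definition "x - y = Cplx (re x - re y) (im x - im y)"

instance
  by standard
    (simp_all add: zero_cplx_def plus_cplx_def uminus_cplx_def minus_cplx_def algebra_simps)

end

definition cscale :: "complex \<Rightarrow> 'a::real_vector cplx \<Rightarrow> 'a cplx" where
  "cscale z x = Cplx (Re z *\<^sub>R re x - Im z *\<^sub>R im x) (Re z *\<^sub>R im x + Im z *\<^sub>R re x)"

global_interpretation cx: vector_space "cscale :: complex \<Rightarrow> 'a::real_vector cplx \<Rightarrow> 'a cplx"
  by unfold_locales
    (simp_all add: cscale_def plus_cplx_def scaleR_add_right scaleR_add_left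
      scaleR_diff_right scaleR_diff_left algebra_simps)

text \<open>The scalar action on a direct sum of two complexifications.\<close>

definition cscale2 ::
  "complex \<Rightarrow> 'a::real_vector cplx \<times> 'a cplx \<Rightarrow> 'a cplx \<times> 'a cplx" where
  "cscale2 z x = (cscale z (fst x), cscale z (snd x))"

global_interpretation cx2: vector_space
  "cscale2 :: complex \<Rightarrow> 'a::real_vector cplx \<times> 'a cplx \<Rightarrow> 'a cplx \<times> 'a cplx"
  by unfold_locales
    (simp_all add: cscale2_def cx.scale_right_distrib cx.scale_left_distrib)

definition complexify :: "'a set \<Rightarrow> 'a cplx set" where
  "complexify V = {x. re x \<in> V \<and> im x \<in> V}"

definition of_re :: "'a::zero \<Rightarrow> 'a cplx" where
  "of_re u = Cplx u 0"

definition conj_cplx :: "'a::uminus cplx \<Rightarrow> 'a cplx" where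
  "conj_cplx x = Cplx (re x) (- im x)"

text \<open>Complex linear and complex bilinear extensions of real (bi)linear maps.\<close>

definition cext :: "('a \<Rightarrow> 'b) \<Rightarrow> 'a cplx \<Rightarrow> 'b cplx" where
  "cext f x = Cplx (f (re x)) (f (im x))"

definition cext2 :: "('a \<Rightarrow> 'a \<Rightarrow> 'b::ab_group_add) \<Rightarrow> 'a cplx \<Rightarrow> 'a cplx \<Rightarrow> 'b cplx" where
  "cext2 B x y = Cplx (B (re x) (re y) - B (im x) (im y)) (B (re x) (im y) + B (im x) (re y))"

text \<open>The trace of a complex linear endomorphism \<open>T\<close> of a finite-dimensional subspace \<open>V\<close>,
  computed in any basis of \<open>V\<close>.\<close>

definition ctrace :: "'a::real_vector cplx set \<Rightarrow> ('a cplx \<Rightarrow> 'a cplx) \<Rightarrow> complex" where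
  "ctrace V T = (let B = (SOME B. B \<subseteq> V \<and> cx.independent B \<and> cx.span B = V)
     in \<Sum>b\<in>B. cx.representation B (T b) b)"


section \<open>Smooth manifolds\<close>

subsection \<open>Smooth functions of \<open>n\<close> real variables\<close>

text \<open>Points of \<open>R^n\<close> are elements of \<open>topspace (Euclidean_space n)\<close>, i.e. functions
  \<open>nat \<Rightarrow> real\<close> vanishing at all indices \<open>i \<ge> n\<close>. This permits dimension 0 and dimensions that
  vary. The predicates are meant for relatively open subsets \<open>U\<close> of \<open>R^n\<close>.\<close>

definition partial_deriv :: "nat \<Rightarrow> ((nat \<Rightarrow> real) \<Rightarrow> real) \<Rightarrow> (nat \<Rightarrow> real) \<Rightarrow> real" where
  "partial_deriv i f x = deriv (\<lambda>t. f (x(i := t))) (x i)"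

primrec C_k_on :: "nat \<Rightarrow> nat \<Rightarrow> (nat \<Rightarrow> real) set \<Rightarrow> ((nat \<Rightarrow> real) \<Rightarrow> real) \<Rightarrow> bool" where
  "C_k_on 0 n U f \<longleftrightarrow> continuous_on U f"
| "C_k_on (Suc k) n U f \<longleftrightarrow> continuous_on U f \<and>
     (\<forall>i<n. (\<forall>x\<in>U. (\<lambda>t. f (x(i := t))) field_differentiable at (x i))
        \<and> C_k_on k n U (partial_deriv i f))"

definition smooth_on :: "nat \<Rightarrow> (nat \<Rightarrow> real) set \<Rightarrow> ((nat \<Rightarrow> real) \<Rightarrow> real) \<Rightarrow> bool" where
  "smooth_on n U f \<longleftrightarrow> (\<forall>k. C_k_on k n U f)"


subsection \<open>Manifolds and smooth maps\<close>

type_synonym 'm chart = "'m set \<times> ('m \<Rightarrow> nat \<Rightarrow> real)"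

text \<open>A manifold lives on all of the topological space \<open>'m\<close>; the atlas need not be maximal.\<close>

record 'm smooth_mfd =
  mdim :: nat
  atlas :: "'m chart set"

definition is_chart :: "nat \<Rightarrow> 'm::topological_space chart \<Rightarrow> bool" where
  "is_chart n c \<longleftrightarrow> open (fst c) \<and> openin (Euclidean_space n) (snd c ` fst c) \<and>
     homeomorphic_map (top_of_set (fst c)) (subtopology (Euclidean_space n) (snd c ` fst c)) (snd c)"

definition chart_inv :: "'m chart \<Rightarrow> (nat \<Rightarrow> real) \<Rightarrow> 'm" where
  "chart_inv c = inv_into (fst c) (snd c)"

definition smooth_manifold ::
  "('m::{t2_space,second_countable_topology}, 'r) smooth_mfd_scheme \<Rightarrow> bool" where
  "smooth_manifold M \<longleftrightarrow> (\<forall>c\<in>atlas M. is_chart (mdim M) c) \<and> \<Union> (fst ` atlas M) = UNIV \<and>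
     (\<forall>c\<in>atlas M. \<forall>c'\<in>atlas M. \<forall>i<mdim M.
        smooth_on (mdim M) (snd c ` (fst c \<inter> fst c')) (\<lambda>x. snd c' (chart_inv c x) i))"

definition smooth_map ::
  "('m::topological_space, 'r) smooth_mfd_scheme \<Rightarrow> ('n::topological_space, 's) smooth_mfd_scheme
     \<Rightarrow> ('m \<Rightarrow> 'n) \<Rightarrow> bool" where
  "smooth_map M N F \<longleftrightarrow> continuous_on UNIV F \<and>
     (\<forall>c\<in>atlas M. \<forall>c'\<in>atlas N. \<forall>i<mdim N.
        smooth_on (mdim M) (snd c ` (fst c \<inter> F -` fst c')) (\<lambda>x. snd c' (F (chart_inv c x)) i))"

definition prod_mfd ::
  "('m, 'r) smooth_mfd_scheme \<Rightarrow> ('n, 's) smooth_mfd_scheme \<Rightarrow> ('m \<times> 'n) smooth_mfd" where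
  "prod_mfd M N = \<lparr>mdim = mdim M + mdim N,
     atlas = {(fst c \<times> fst c', \<lambda>(p, q) i. if i < mdim M then snd c p i else snd c' q (i - mdim M))
              | c c'. c \<in> atlas M \<and> c' \<in> atlas N}\<rparr>"

definition smooth_fun ::
  "('m::topological_space, 'r) smooth_mfd_scheme \<Rightarrow> 'm set \<Rightarrow> ('m \<Rightarrow> real) \<Rightarrow> bool" where
  "smooth_fun M U f \<longleftrightarrow>
     (\<forall>c\<in>atlas M. smooth_on (mdim M) (snd c ` (fst c \<inter> U)) (f \<circ> chart_inv c))"

definition smooth_near ::
  "('m::topological_space, 'r) smooth_mfd_scheme \<Rightarrow> 'm \<Rightarrow> ('m \<Rightarrow> real) \<Rightarrow> bool" where
  "smooth_near M p f \<longleftrightarrow> (\<exists>U. open U \<and> p \<in> U \<and> smooth_fun M U f)"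


subsection \<open>Tangent vectors, vector fields and forms\<close>

text \<open>A tangent vector at \<open>p\<close> is the directional derivative, in some chart around \<open>p\<close>, acting on
  the functions that are smooth near \<open>p\<close>; it is set to 0 on all other functions, so that equality
  of tangent vectors is equality of functions. Likewise covectors at \<open>p\<close>, as functions on
  tangent vectors, are set to 0 outside the tangent space at \<open>p\<close>.\<close>

type_synonym 'm tvec = "('m \<Rightarrow> real) \<Rightarrow> real"
type_synonym 'm covec = "'m tvec \<Rightarrow> real"

definition tangent ::
  "('m::topological_space, 'r) smooth_mfd_scheme \<Rightarrow> 'm \<Rightarrow> 'm tvec set" where
  "tangent M p = {v. \<exists>c\<in>atlas M. \<exists>w. p \<in> fst c \<and>
     v = (\<lambda>f. if smooth_near M p f
              then \<Sum>i<mdim M. w i * partial_deriv i (f \<circ> chart_inv c) (snd c p) else 0)}"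

definition cotangent ::
  "('m::topological_space, 'r) smooth_mfd_scheme \<Rightarrow> 'm \<Rightarrow> 'm covec set" where
  "cotangent M p = {\<xi>. linear_on (tangent M p) \<xi> \<and> (\<forall>v. v \<notin> tangent M p \<longrightarrow> \<xi> v = 0)}"

text \<open>The differential at a point \<open>p\<close> of a smooth self-map \<open>F\<close>, where \<open>q = F p\<close>.\<close>

definition push ::
  "('m::topological_space, 'r) smooth_mfd_scheme \<Rightarrow> ('m \<Rightarrow> 'm) \<Rightarrow> 'm \<Rightarrow> 'm tvec \<Rightarrow> 'm tvec" where
  "push M F q v = (\<lambda>f. if smooth_near M q f then v (f \<circ> F) else 0)"

definition vector_field ::
  "('m::topological_space, 'r) smooth_mfd_scheme \<Rightarrow> ('m \<Rightarrow> 'm tvec) \<Rightarrow> bool" where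
  "vector_field M X \<longleftrightarrow> (\<forall>p. X p \<in> tangent M p) \<and>
     (\<forall>U f. open U \<and> smooth_fun M U f \<longrightarrow> smooth_fun M U (\<lambda>p. X p f))"

definition one_form ::
  "('m::topological_space, 'r) smooth_mfd_scheme \<Rightarrow> ('m \<Rightarrow> 'm covec) \<Rightarrow> bool" where
  "one_form M \<xi> \<longleftrightarrow> (\<forall>p. \<xi> p \<in> cotangent M p) \<and>
     (\<forall>Z. vector_field M Z \<longrightarrow> smooth_fun M UNIV (\<lambda>p. \<xi> p (Z p)))"

definition lie_bracket ::
  "('m::topological_space, 'r) smooth_mfd_scheme \<Rightarrow> ('m \<Rightarrow> 'm tvec) \<Rightarrow> ('m \<Rightarrow> 'm tvec) \<Rightarrow> 'm
     \<Rightarrow> 'm tvec" where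
  "lie_bracket M X Y p =
     (\<lambda>f. if smooth_near M p f then X p (\<lambda>q. Y q f) - Y p (\<lambda>q. X q f) else 0)"

text \<open>Some vector field with value \<open>v\<close> at \<open>p\<close>. It serves to evaluate tensorial expressions,
  whose values at \<open>p\<close> do not depend on the choice.\<close>

definition extend ::
  "('m::topological_space, 'r) smooth_mfd_scheme \<Rightarrow> 'm \<Rightarrow> 'm tvec \<Rightarrow> 'm \<Rightarrow> 'm tvec" where
  "extend M p v = (SOME V. vector_field M V \<and> V p = v)"

definition lie_deriv ::
  "('m::topological_space, 'r) smooth_mfd_scheme \<Rightarrow> ('m \<Rightarrow> 'm tvec) \<Rightarrow> ('m \<Rightarrow> 'm covec) \<Rightarrow> 'm
     \<Rightarrow> 'm covec" where
  "lie_deriv M X \<eta> p v = (let V = extend M p v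
     in X p (\<lambda>q. \<eta> q (V q)) - \<eta> p (lie_bracket M X V p))"

definition ext_deriv ::
  "('m::topological_space, 'r) smooth_mfd_scheme \<Rightarrow> ('m \<Rightarrow> 'm covec) \<Rightarrow> 'm
     \<Rightarrow> 'm tvec \<Rightarrow> 'm tvec \<Rightarrow> real" where
  "ext_deriv M \<xi> p u v = (let U = extend M p u; V = extend M p v
     in U p (\<lambda>q. \<xi> q (V q)) - V p (\<lambda>q. \<xi> q (U q)) - \<xi> p (lie_bracket M U V p))"

type_synonym 'm three_form = "'m \<Rightarrow> 'm tvec \<Rightarrow> 'm tvec \<Rightarrow> 'm tvec \<Rightarrow> real"

definition three_form ::
  "('m::topological_space, 'r) smooth_mfd_scheme \<Rightarrow> 'm three_form \<Rightarrow> bool" where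
  "three_form M \<gamma> \<longleftrightarrow>
     (\<forall>p. \<forall>u\<in>tangent M p. \<forall>v\<in>tangent M p. linear_on (tangent M p) (\<gamma> p u v)
        \<and> (\<forall>w\<in>tangent M p. \<gamma> p v u w = - \<gamma> p u v w \<and> \<gamma> p u w v = - \<gamma> p u v w)) \<and>
     (\<forall>X Y Z. vector_field M X \<and> vector_field M Y \<and> vector_field M Z
        \<longrightarrow> smooth_fun M UNIV (\<lambda>p. \<gamma> p (X p) (Y p) (Z p)))"

definition closed_three_form ::
  "('m::topological_space, 'r) smooth_mfd_scheme \<Rightarrow> 'm three_form \<Rightarrow> bool" where
  "closed_three_form M \<gamma> \<longleftrightarrow> three_form M \<gamma> \<and>
     (\<forall>X Y Z W p. vector_field M X \<and> vector_field M Y \<and> vector_field M Z \<and> vector_field M W \<longrightarrow>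
          X p (\<lambda>q. \<gamma> q (Y q) (Z q) (W q)) - Y p (\<lambda>q. \<gamma> q (X q) (Z q) (W q))
        + Z p (\<lambda>q. \<gamma> q (X q) (Y q) (W q)) - W p (\<lambda>q. \<gamma> q (X q) (Y q) (Z q))
        - \<gamma> p (lie_bracket M X Y p) (Z p) (W p) + \<gamma> p (lie_bracket M X Z p) (Y p) (W p)
        - \<gamma> p (lie_bracket M X W p) (Y p) (Z p) - \<gamma> p (lie_bracket M Y Z p) (X p) (W p)
        + \<gamma> p (lie_bracket M Y W p) (X p) (Z p) - \<gamma> p (lie_bracket M Z W p) (X p) (Y p) = 0)"

type_synonym 'm metric = "'m \<Rightarrow> 'm tvec \<Rightarrow> 'm tvec \<Rightarrow> real"

definition riemannian_metric ::
  "('m::topological_space, 'r) smooth_mfd_scheme \<Rightarrow> 'm metric \<Rightarrow> bool" where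
  "riemannian_metric M g \<longleftrightarrow>
     (\<forall>p. bilinear_on (tangent M p) (g p)
        \<and> (\<forall>u\<in>tangent M p. \<forall>v\<in>tangent M p. g p u v = g p v u)
        \<and> (\<forall>u\<in>tangent M p. u \<noteq> 0 \<longrightarrow> g p u u > 0)) \<and>
     (\<forall>X Y. vector_field M X \<and> vector_field M Y \<longrightarrow> smooth_fun M UNIV (\<lambda>p. g p (X p) (Y p)))"

text \<open>A metric as an isomorphism from tangent to cotangent vectors, and its inverse.\<close>

definition flat ::
  "('m::topological_space, 'r) smooth_mfd_scheme \<Rightarrow> 'm metric \<Rightarrow> 'm \<Rightarrow> 'm tvec \<Rightarrow> 'm covec" where
  "flat M g p u = (\<lambda>v. if v \<in> tangent M p then g p u v else 0)"

definition sharp ::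
  "('m::topological_space, 'r) smooth_mfd_scheme \<Rightarrow> 'm metric \<Rightarrow> 'm \<Rightarrow> 'm covec \<Rightarrow> 'm tvec" where
  "sharp M g p = inv_into (tangent M p) (flat M g p)"


section \<open>Generalized geometry\<close>

type_synonym 'm gvec = "'m tvec \<times> 'm covec"

definition gtangent ::
  "('m::topological_space, 'r) smooth_mfd_scheme \<Rightarrow> 'm \<Rightarrow> 'm gvec set" where
  "gtangent M p = tangent M p \<times> cotangent M p"

definition pairing :: "'m gvec \<Rightarrow> 'm gvec \<Rightarrow> real" where
  "pairing x y = (snd y (fst x) + snd x (fst y)) / 2"

definition gsection ::
  "('m::topological_space, 'r) smooth_mfd_scheme \<Rightarrow> ('m \<Rightarrow> 'm gvec) \<Rightarrow> bool" where
  "gsection M s \<longleftrightarrow> vector_field M (fst \<circ> s) \<and> one_form M (snd \<circ> s)"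

text \<open>In the last term, \<open>\<iota>\<^sub>X \<iota>\<^sub>Y \<gamma> = \<gamma>(Y, X, _)\<close>.\<close>

definition dorfman ::
  "('m::topological_space, 'r) smooth_mfd_scheme \<Rightarrow> 'm three_form
     \<Rightarrow> ('m \<Rightarrow> 'm gvec) \<Rightarrow> ('m \<Rightarrow> 'm gvec) \<Rightarrow> 'm \<Rightarrow> 'm gvec" where
  "dorfman M \<gamma> s t p = (let X = fst \<circ> s; \<xi> = snd \<circ> s; Y = fst \<circ> t; \<eta> = snd \<circ> t in
     (lie_bracket M X Y p,
      (\<lambda>v. if v \<in> tangent M p
           then lie_deriv M X \<eta> p v - ext_deriv M \<xi> p (Y p) v + \<gamma> p (Y p) (X p) v else 0)))"

text \<open>Sections of the complexified bundle and the complex bilinear extension of the bracket.\<close>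

definition cgsection ::
  "('m::topological_space, 'r) smooth_mfd_scheme \<Rightarrow> ('m \<Rightarrow> 'm gvec cplx) \<Rightarrow> bool" where
  "cgsection M s \<longleftrightarrow> gsection M (re \<circ> s) \<and> gsection M (im \<circ> s)"

definition cdorfman ::
  "('m::topological_space, 'r) smooth_mfd_scheme \<Rightarrow> 'm three_form
     \<Rightarrow> ('m \<Rightarrow> 'm gvec cplx) \<Rightarrow> ('m \<Rightarrow> 'm gvec cplx) \<Rightarrow> 'm \<Rightarrow> 'm gvec cplx" where
  "cdorfman M \<gamma> s t p = Cplx
     (dorfman M \<gamma> (re \<circ> s) (re \<circ> t) p - dorfman M \<gamma> (im \<circ> s) (im \<circ> t) p)
     (dorfman M \<gamma> (re \<circ> s) (im \<circ> t) p + dorfman M \<gamma> (im \<circ> s) (re \<circ> t) p)"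

definition i_eigenbundle ::
  "('m::topological_space, 'r) smooth_mfd_scheme \<Rightarrow> ('m \<Rightarrow> 'm gvec \<Rightarrow> 'm gvec) \<Rightarrow> 'm
     \<Rightarrow> 'm gvec cplx set" where
  "i_eigenbundle M J p = {x \<in> complexify (gtangent M p). cext (J p) x = cscale \<i> x}"

definition gen_complex ::
  "('m::topological_space, 'r) smooth_mfd_scheme \<Rightarrow> 'm three_form
     \<Rightarrow> ('m \<Rightarrow> 'm gvec \<Rightarrow> 'm gvec) \<Rightarrow> bool" where
  "gen_complex M \<gamma> J \<longleftrightarrow> closed_three_form M \<gamma> \<and>
     (\<forall>p. linear_on (gtangent M p) (J p) \<and> J p ` gtangent M p \<subseteq> gtangent M p
        \<and> (\<forall>x\<in>gtangent M p. J p (J p x) = - x)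
        \<and> (\<forall>x\<in>gtangent M p. \<forall>y\<in>gtangent M p. pairing (J p x) (J p y) = pairing x y)) \<and>
     (\<forall>s. gsection M s \<longrightarrow> gsection M (\<lambda>p. J p (s p))) \<and>
     (\<forall>s t. cgsection M s \<and> cgsection M t
        \<and> (\<forall>p. s p \<in> i_eigenbundle M J p) \<and> (\<forall>p. t p \<in> i_eigenbundle M J p)
        \<longrightarrow> (\<forall>p. cdorfman M \<gamma> s t p \<in> i_eigenbundle M J p))"

definition gen_kahler ::
  "('m::topological_space, 'r) smooth_mfd_scheme \<Rightarrow> 'm three_form
     \<Rightarrow> ('m \<Rightarrow> 'm gvec \<Rightarrow> 'm gvec) \<Rightarrow> ('m \<Rightarrow> 'm gvec \<Rightarrow> 'm gvec) \<Rightarrow> 'm metric \<Rightarrow> bool" where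
  "gen_kahler M \<gamma> Jp Jm g \<longleftrightarrow> gen_complex M \<gamma> Jp \<and> gen_complex M \<gamma> Jm \<and> riemannian_metric M g \<and>
     (\<forall>p. \<forall>x\<in>gtangent M p. Jp p (Jm p x) = Jm p (Jp p x)) \<and>
     (\<forall>p. \<forall>v\<in>tangent M p. \<forall>\<xi>\<in>cotangent M p.
        - Jp p (Jm p (v, \<xi>)) = (sharp M g p \<xi>, flat M g p v))"


section \<open>Lie groups\<close>

record 'm lie_grp = "'m smooth_mfd" +
  gmult :: "'m \<Rightarrow> 'm \<Rightarrow> 'm"
  gone :: 'm
  ginv :: "'m \<Rightarrow> 'm"

definition lie_group :: "'k::{t2_space,second_countable_topology} lie_grp \<Rightarrow> bool" where
  "lie_group K \<longleftrightarrow> smooth_manifold K \<and> group (gmult K) (gone K) (ginv K) \<and>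
     smooth_map (prod_mfd K K) K (\<lambda>(p, q). gmult K p q) \<and> smooth_map K K (ginv K)"

definition liek :: "'k::topological_space lie_grp \<Rightarrow> 'k tvec set" where
  "liek K = tangent K (gone K)"

text \<open>The right and left invariant vector fields with a given value at the identity.\<close>

definition right_field :: "'k::topological_space lie_grp \<Rightarrow> 'k tvec \<Rightarrow> 'k \<Rightarrow> 'k tvec" where
  "right_field K a p = push K (\<lambda>x. gmult K x p) p a"

definition left_field :: "'k::topological_space lie_grp \<Rightarrow> 'k tvec \<Rightarrow> 'k \<Rightarrow> 'k tvec" where
  "left_field K a p = push K (\<lambda>x. gmult K p x) p a"

text \<open>The right and left invariant Cartan forms.\<close>

definition theta_r :: "'k::topological_space lie_grp \<Rightarrow> 'k \<Rightarrow> 'k tvec \<Rightarrow> 'k tvec" where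
  "theta_r K p v = push K (\<lambda>x. gmult K x (ginv K p)) (gone K) v"

definition theta_l :: "'k::topological_space lie_grp \<Rightarrow> 'k \<Rightarrow> 'k tvec \<Rightarrow> 'k tvec" where
  "theta_l K p v = push K (\<lambda>x. gmult K (ginv K p) x) (gone K) v"

text \<open>The bracket is that of the \<^emph>\<open>right\<close> invariant vector fields.\<close>

definition liek_br :: "'k::topological_space lie_grp \<Rightarrow> 'k tvec \<Rightarrow> 'k tvec \<Rightarrow> 'k tvec" where
  "liek_br K a b = lie_bracket K (right_field K a) (right_field K b) (gone K)"

type_synonym 'k cvec = "'k tvec cplx"

definition lieg :: "'k::topological_space lie_grp \<Rightarrow> 'k cvec set" where
  "lieg K = complexify (liek K)"

definition lieg_br :: "'k::topological_space lie_grp \<Rightarrow> 'k cvec \<Rightarrow> 'k cvec \<Rightarrow> 'k cvec" where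
  "lieg_br K = cext2 (liek_br K)"

definition derived_alg :: "'k::topological_space lie_grp \<Rightarrow> 'k cvec set" where
  "derived_alg K = cx.span {lieg_br K a b | a b. a \<in> lieg K \<and> b \<in> lieg K}"

definition center_alg :: "'k::topological_space lie_grp \<Rightarrow> 'k cvec set" where
  "center_alg K = {a \<in> lieg K. \<forall>b\<in>lieg K. lieg_br K a b = 0}"

text \<open>\<open>\<sigma>\<close> and \<open>\<gamma>\<close> have the values \<open>\<kappa>(a, b)\<close> and \<open>\<kappa>(a, [b, c])\<close> on right invariant vector
  fields; these are real for real arguments by \<open>invariant_form\<close> below.\<close>

definition sigma ::
  "'k::topological_space lie_grp \<Rightarrow> ('k cvec \<Rightarrow> 'k cvec \<Rightarrow> complex) \<Rightarrow> 'k metric" where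
  "sigma K \<kappa> p u v = Re (\<kappa> (of_re (theta_r K p u)) (of_re (theta_r K p v)))"

definition cartan_three_form ::
  "'k::topological_space lie_grp \<Rightarrow> ('k cvec \<Rightarrow> 'k cvec \<Rightarrow> complex) \<Rightarrow> 'k three_form" where
  "cartan_three_form K \<kappa> p u v w =
     Re (\<kappa> (of_re (theta_r K p u)) (of_re (liek_br K (theta_r K p v) (theta_r K p w))))"

definition bi_invariant_metric :: "'k::topological_space lie_grp \<Rightarrow> 'k metric \<Rightarrow> bool" where
  "bi_invariant_metric K g \<longleftrightarrow> riemannian_metric K g \<and>
     (\<forall>p q. \<forall>u\<in>tangent K q. \<forall>v\<in>tangent K q.
        g (gmult K q p) (push K (\<lambda>x. gmult K x p) (gmult K q p) u)
          (push K (\<lambda>x. gmult K x p) (gmult K q p) v) = g q u v \<and>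
        g (gmult K p q) (push K (\<lambda>x. gmult K p x) (gmult K p q) u)
          (push K (\<lambda>x. gmult K p x) (gmult K p q) v) = g q u v)"

definition invariant_form ::
  "'k::topological_space lie_grp \<Rightarrow> ('k cvec \<Rightarrow> 'k cvec \<Rightarrow> complex) \<Rightarrow> bool" where
  "invariant_form K \<kappa> \<longleftrightarrow>
     (\<forall>a\<in>lieg K. \<forall>b\<in>lieg K. \<kappa> a b = \<kappa> b a
        \<and> (\<forall>c\<in>lieg K. \<kappa> (a + b) c = \<kappa> a c + \<kappa> b c)
        \<and> (\<forall>z. \<kappa> (cscale z a) b = z * \<kappa> a b)
        \<and> (\<forall>c\<in>lieg K. \<kappa> (lieg_br K a b) c = \<kappa> a (lieg_br K b c))) \<and>
     (\<forall>a\<in>derived_alg K. \<forall>b\<in>derived_alg K.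
        \<kappa> a b = - ctrace (lieg K) (lieg_br K a \<circ> lieg_br K b)) \<and>
     (\<forall>a\<in>derived_alg K. \<forall>b\<in>center_alg K. \<kappa> a b = 0) \<and>
     (\<forall>a\<in>liek K. \<forall>b\<in>liek K. \<kappa> (of_re a) (of_re b) \<in> \<real>) \<and>
     bi_invariant_metric K (sigma K \<kappa>)"


subsection \<open>The double and Lie algebraic structures\<close>

text \<open>An element of \<open>d = g \<oplus> g\<close> is a pair \<open>(a, a')\<close>; the bracket is componentwise.\<close>

definition lied :: "'k::topological_space lie_grp \<Rightarrow> ('k cvec \<times> 'k cvec) set" where
  "lied K = lieg K \<times> lieg K"

definition lied_br ::
  "'k::topological_space lie_grp \<Rightarrow> 'k cvec \<times> 'k cvec \<Rightarrow> 'k cvec \<times> 'k cvec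
     \<Rightarrow> 'k cvec \<times> 'k cvec" where
  "lied_br K x y = (lieg_br K (fst x) (fst y), lieg_br K (snd x) (snd y))"

definition lied_form ::
  "('k cvec \<Rightarrow> 'k cvec \<Rightarrow> complex) \<Rightarrow> 'k cvec \<times> 'k cvec \<Rightarrow> 'k cvec \<times> 'k cvec \<Rightarrow> complex" where
  "lied_form \<kappa> x y = - \<kappa> (fst x) (fst y) + \<kappa> (snd x) (snd y)"

definition lagrangian_subalgebra ::
  "'k::topological_space lie_grp \<Rightarrow> ('k cvec \<Rightarrow> 'k cvec \<Rightarrow> complex)
     \<Rightarrow> ('k cvec \<times> 'k cvec) set \<Rightarrow> bool" where
  "lagrangian_subalgebra K \<kappa> L \<longleftrightarrow> cx2.subspace L \<and> L \<subseteq> lied K \<and>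
     (\<forall>x\<in>L. \<forall>y\<in>L. lied_br K x y \<in> L) \<and>
     L = {x \<in> lied K. \<forall>y\<in>L. lied_form \<kappa> x y = 0}"

definition courant_triv ::
  "'k::topological_space lie_grp \<Rightarrow> ('k cvec \<Rightarrow> 'k cvec \<Rightarrow> complex)
     \<Rightarrow> 'k cvec \<times> 'k cvec \<Rightarrow> 'k \<Rightarrow> 'k gvec cplx" where
  "courant_triv K \<kappa> x p = (let a = fst x; a' = snd x;
       \<xi> = (\<lambda>v. \<kappa> (of_re (theta_r K p v)) a' + \<kappa> (of_re (theta_l K p v)) a) in
     Cplx
       (right_field K (re a') p - left_field K (re a) p,
        \<lambda>v. if v \<in> tangent K p then Re (\<xi> v) else 0)
       (right_field K (im a') p - left_field K (im a) p,
        \<lambda>v. if v \<in> tangent K p then Im (\<xi> v) else 0))"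

text \<open>The subalgebra \<open>L\<close> defines the Lie algebraic generalized complex structure \<open>J\<close>.\<close>

definition defines_gc ::
  "'k::topological_space lie_grp \<Rightarrow> ('k cvec \<Rightarrow> 'k cvec \<Rightarrow> complex)
     \<Rightarrow> ('k cvec \<times> 'k cvec) set \<Rightarrow> ('k \<Rightarrow> 'k gvec \<Rightarrow> 'k gvec) \<Rightarrow> bool" where
  "defines_gc K \<kappa> L J \<longleftrightarrow> gen_complex K (cartan_three_form K \<kappa>) J \<and>
     lagrangian_subalgebra K \<kappa> L \<and> L \<inter> (of_re ` liek K \<times> of_re ` liek K) = {0} \<and>
     (\<forall>p. i_eigenbundle K J p = cx.span ((\<lambda>x. courant_triv K \<kappa> x p) ` L))"

definition lie_algebraic_gc ::
  "'k::topological_space lie_grp \<Rightarrow> ('k cvec \<Rightarrow> 'k cvec \<Rightarrow> complex)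
     \<Rightarrow> ('k \<Rightarrow> 'k gvec \<Rightarrow> 'k gvec) \<Rightarrow> bool" where
  "lie_algebraic_gc K \<kappa> J \<longleftrightarrow> (\<exists>L. defines_gc K \<kappa> L J)"

definition lie_algebraic_gk ::
  "'k::topological_space lie_grp \<Rightarrow> ('k cvec \<Rightarrow> 'k cvec \<Rightarrow> complex)
     \<Rightarrow> ('k \<Rightarrow> 'k gvec \<Rightarrow> 'k gvec) \<Rightarrow> ('k \<Rightarrow> 'k gvec \<Rightarrow> 'k gvec) \<Rightarrow> bool" where
  "lie_algebraic_gk K \<kappa> Jp Jm \<longleftrightarrow>
     gen_kahler K (cartan_three_form K \<kappa>) Jp Jm (sigma K \<kappa>) \<and>
     lie_algebraic_gc K \<kappa> Jp \<and> lie_algebraic_gc K \<kappa> Jm"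


subsection \<open>Samelson subalgebras\<close>

text \<open>The last conjunct says that the complex structure \<open>I\<close> on \<open>k\<close> with \<open>i\<close>-eigenspace \<open>l\<close> is
  \<open>\<kappa>\<close>-orthogonal; integrability of \<open>I\<close> is the closure of \<open>l\<close> under the bracket.\<close>

definition samelson ::
  "'k::topological_space lie_grp \<Rightarrow> ('k cvec \<Rightarrow> 'k cvec \<Rightarrow> complex) \<Rightarrow> 'k cvec set \<Rightarrow> bool" where
  "samelson K \<kappa> l \<longleftrightarrow> cx.subspace l \<and> l \<subseteq> lieg K \<and>
     (\<forall>a\<in>l. \<forall>b\<in>l. lieg_br K a b \<in> l) \<and>
     2 * cx.dim l = mdim K \<and> l \<inter> of_re ` liek K = {0} \<and>
     (\<exists>I. linear_on (liek K) I \<and> I ` liek K \<subseteq> liek K \<and> (\<forall>a\<in>liek K. I (I a) = - a)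
        \<and> l = {x \<in> lieg K. cext I x = cscale \<i> x}
        \<and> (\<forall>a\<in>liek K. \<forall>b\<in>liek K. \<kappa> (of_re (I a)) (of_re (I b)) = \<kappa> (of_re a) (of_re b)))"

end

theory Submission
  imports Defs
begin

text \<open>Everything takes place in the fibre over the identity \<open>e\<close>. Since \<open>J\<^sub>\<plusminus>\<close> commute and
  \<open>- J\<^sub>+ J\<^sub>-\<close> is the involution given by \<open>\<sigma>\<close>, both preserve its eigenspaces, the graphs of \<open>\<plusminus>\<sigma>\<close>,
  so they induce orthogonal complex structures \<open>A\<close> and \<open>B\<close> on \<open>k\<close>; moreover \<open>J\<^sub>- = \<plusminus>J\<^sub>+\<close> on the
  graph of \<open>\<plusminus>\<sigma>\<close>. The Courant trivialization at \<open>e\<close> sends \<open>(a, a')\<close> to the point over \<open>a'\<close> of the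
  graph of \<open>\<sigma>\<close> minus the point over \<open>a\<close> of the graph of \<open>-\<sigma>\<close>. Hence \<open>L\<^sub>+\<close> is contained in the
  product of the \<open>i\<close>-eigenspaces of \<open>B\<close> and \<open>A\<close>, and \<open>L\<^sub>-\<close> in the product with \<open>- B\<close> instead of
  \<open>B\<close>. These products are isotropic, so the Lagrangian \<open>L\<^sub>\<plusminus>\<close> fill them.\<close>

section \<open>Tangent spaces\<close>

lemma tendsto_fun_componentwise:
  fixes h :: "'a \<Rightarrow> 'b \<Rightarrow> 'c::topological_space"
  assumes "\<And>j. ((\<lambda>t. h t j) \<longlongrightarrow> y j) F"
  shows "(h \<longlongrightarrow> y) F"
  using assms limitin_componentwise[of "\<lambda>_. euclidean" UNIV h y F]
  by (simp add: euclidean_product_topology)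

text \<open>A squeeze in each coordinate: \<open>h t\<close> stays in the box with opposite corners
  \<open>y\<close> and \<open>g t\<close>. It applies to points that are merely chosen in such boxes
  and have no continuity of their own.\<close>

lemma tendsto_fun_between:
  fixes g h :: "'a \<Rightarrow> 'b \<Rightarrow> real"
  assumes g: "\<And>j. ((\<lambda>t. g t j) \<longlongrightarrow> y j) F"
    and h: "\<forall>\<^sub>F t in F. \<forall>j. h t j \<in> closed_segment (y j) (g t j)"
  shows "(h \<longlongrightarrow> y) F"
proof (rule tendsto_fun_componentwise)
  fix j
  have "((\<lambda>t. \<bar>g t j - y j\<bar>) \<longlongrightarrow> 0) F"
    using g[of j] by (simp add: LIM_zero tendsto_rabs_zero)
  moreover have "\<forall>\<^sub>F t in F. norm (h t j - y j) \<le> \<bar>g t j - y j\<bar>"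
    using h 
  proof eventually_elim
    case (elim t)
    then have "h t j \<in> closed_segment (y j) (g t j)" by blast
    then show ?case by (auto simp: closed_segment_eq_real_ivl split: if_splits)
  qed
  ultimately have "((\<lambda>t. h t j - y j) \<longlongrightarrow> 0) F"
    by (rule Lim_null_comparison[rotated])
  then show "((\<lambda>t. h t j) \<longlongrightarrow> y j) F"
    by (rule LIM_zero_cancel)
qed

text \<open>Closed segments cover both orders of \<open>a\<close> and \<open>b\<close> as well as
  \<open>a = b\<close>, since a coordinate of a curve may increase, decrease or stand still.\<close>

lemma mean_value_segment:
  fixes h h' :: "real \<Rightarrow> real"
  assumes "\<And>s. s \<in> closed_segment a b \<Longrightarrow> (h has_field_derivative h' s) (at s)"
  shows "\<exists>s\<in>closed_segment a b. h b - h a = (b - a) * h' s"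
proof (cases a b rule: linorder_cases)
  case less
  with MVT2[OF less, of h h'] assms show ?thesis
    by (force simp: closed_segment_eq_real_ivl)
next
  case greater
  have "\<exists>s>b. s < a \<and> h a - h b = (a - b) * h' s"
    using greater assms by (intro MVT2) (auto simp: closed_segment_eq_real_ivl)
  then obtain s where "b < s" "s < a" "h a - h b = (a - b) * h' s"
    by blast
  with greater show ?thesis
    by (intro bexI[of _ s]) (auto simp: closed_segment_eq_real_ivl algebra_simps)
qed auto

text \<open>If the boxes did not eventually lie in \<open>W\<close>, a choice of points outside
  \<open>W\<close> would still be squeezed to \<open>y\<close>, and so would end up in any open set
  around \<open>y\<close>.\<close>

lemma eventually_between_in_open:
  fixes g :: "'a \<Rightarrow> nat \<Rightarrow> real"
  assumes W: "openin (Euclidean_space n) W" and y: "y \<in> W"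
    and g: "\<And>j. ((\<lambda>t. g t j) \<longlongrightarrow> y j) F"
  shows "\<forall>\<^sub>F t in F. \<forall>x\<in>topspace (Euclidean_space n).
           (\<forall>j. x j \<in> closed_segment (y j) (g t j)) \<longrightarrow> x \<in> W"
proof -
  obtain T where T: "open T" "W = T \<inter> topspace (Euclidean_space n)"
    using W by (auto simp: Euclidean_space_def openin_subtopology euclidean_product_topology
        topspace_Euclidean_space)
  define bad where "bad t x \<longleftrightarrow> x \<in> topspace (Euclidean_space n)
      \<and> (\<forall>j. x j \<in> closed_segment (y j) (g t j)) \<and> x \<notin> W" for t x
  \<comment> \<open>\<open>h\<close> picks a counterexample wherever one exists. Its default
    \<open>y\<close> lies in every box, so the squeeze applies for all \<open>t\<close>.\<close>
  define h where "h t = (if \<exists>x. bad t x then SOME x. bad t x else y)" for t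
  have h: "bad t (h t)" if "bad t x" for t x
    unfolding h_def using that by (metis someI)
  have "\<forall>j. h t j \<in> closed_segment (y j) (g t j)" for t
  proof (cases "\<exists>x. bad t x")
    case True
    with h show ?thesis by (auto simp: bad_def)
  qed (auto simp: h_def)
  then have "(h \<longlongrightarrow> y) F"
    by (intro tendsto_fun_between[OF g]) auto
  with T y have "\<forall>\<^sub>F t in F. h t \<in> T"
    by (auto intro: topological_tendstoD)
  then show ?thesis
  proof eventually_elim
    case (elim t)
    show ?case
    proof (intro ballI impI, rule ccontr)
      fix x assume "x \<in> topspace (Euclidean_space n)"
        "\<forall>j. x j \<in> closed_segment (y j) (g t j)" "x \<notin> W"
      then have "bad t (h t)" by (intro h[of t x]) (simp add: bad_def)
      with elim T show False by (auto simp: bad_def)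
    qed
  qed
qed

lemma C_k_on_has_partial_deriv:
  assumes "C_k_on (Suc k) n W f" "i < n" "x \<in> W"
  shows "((\<lambda>t. f (x(i := t))) has_field_derivative partial_deriv i f x) (at (x i))"
  using assms unfolding partial_deriv_def
  by (auto simp: DERIV_deriv_iff_field_differentiable)

text \<open>The chain rule along a curve. The increment of \<open>f\<close> is telescoped over the points \<open>z k t\<close>,
  which move from \<open>g t0\<close> to \<open>g t\<close> one coordinate at a time, with the mean value theorem for each
  step.\<close>

lemma C_k_on_has_field_derivative_curve:
  fixes g :: "real \<Rightarrow> nat \<Rightarrow> real"
  assumes f: "C_k_on 1 n W f" and W: "openin (Euclidean_space n) W"
    and g0: "g t0 \<in> W"
    and gE: "\<forall>\<^sub>F t in at t0. g t \<in> topspace (Euclidean_space n)"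
    and d: "\<And>j. j < n \<Longrightarrow> ((\<lambda>t. g t j) has_field_derivative d j) (at t0)"
  shows "((\<lambda>t. f (g t)) has_field_derivative (\<Sum>j<n. d j * partial_deriv j f (g t0))) (at t0)"
proof -
  define y where "y = g t0"
  have WE: "W \<subseteq> topspace (Euclidean_space n)"
    using W by (rule openin_subset)
  have y0: "y j = 0" if "n \<le> j" for j
    using g0 WE that by (auto simp: y_def topspace_Euclidean_space)
  \<comment> \<open>Beyond the first \<open>n\<close> coordinates there is no derivative to appeal
    to; there \<open>g t j\<close> and \<open>y j\<close> are both 0 near \<open>t0\<close>.\<close>
  have lim: "((\<lambda>t. g t j) \<longlongrightarrow> y j) (at t0)" for j
  proof (cases "j < n")
    case True
    then show ?thesis
      using DERIV_isCont[OF d[OF True]] by (simp add: isCont_def y_def)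
  next
    case False
    have "\<forall>\<^sub>F t in at t0. y j = g t j"
      using gE by eventually_elim (use False y0 in \<open>auto simp: topspace_Euclidean_space\<close>)
    then show ?thesis
      by (rule Lim_transform_eventually[OF tendsto_const])
  qed
  define z where "z k t = (\<lambda>j. if j < k then g t j else y j)" for k :: nat and t
  \<comment> \<open>The value of coordinate \<open>k\<close> that the mean value theorem provides
    for the step from \<open>z k t\<close> to \<open>z (Suc k) t\<close>; \<open>\<xi> k t\<close>
    below is the corresponding point.\<close>
  define s where "s k t = (SOME s. s \<in> closed_segment (y k) (g t k) \<and>
      f (z (Suc k) t) - f (z k t) = (g t k - y k) * partial_deriv k f ((z k t)(k := s)))" for k t
  define \<xi> where "\<xi> k t = (z k t)(k := s k t)" for k t
  \<comment> \<open>All intermediate points lie in the box between \<open>y\<close> and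
    \<open>g t\<close>, hence in \<open>W\<close>, where the partial derivatives exist.\<close>
  have box: "\<forall>\<^sub>F t in at t0. \<forall>x\<in>topspace (Euclidean_space n).
      (\<forall>j. x j \<in> closed_segment (y j) (g t j)) \<longrightarrow> x \<in> W"
    by (rule eventually_between_in_open[OF W g0[folded y_def] lim])
  have key: "\<forall>\<^sub>F t in at t0. \<forall>k<n. \<xi> k t \<in> W \<and> s k t \<in> closed_segment (y k) (g t k) \<and>
      f (z (Suc k) t) - f (z k t) = (g t k - y k) * partial_deriv k f (\<xi> k t)"
    using box gE
  proof eventually_elim
    case (elim t)
    show ?case
    proof (intro allI impI)
      fix k assume k: "k < n"
      have inW: "(z k t)(k := r) \<in> W" if "r \<in> closed_segment (y k) (g t k)" for r
      proof -
        have "(z k t)(k := r) \<in> topspace (Euclidean_space n)"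
          using k elim(2) y0 by (auto simp: z_def topspace_Euclidean_space)
        moreover have "\<forall>j. ((z k t)(k := r)) j \<in> closed_segment (y j) (g t j)"
          using that by (auto simp: z_def)
        ultimately show ?thesis using elim(1) by blast
      qed
      have "((\<lambda>r. f ((z k t)(k := r))) has_field_derivative
          partial_deriv k f ((z k t)(k := r))) (at r)"
        if "r \<in> closed_segment (y k) (g t k)" for r
        using C_k_on_has_partial_deriv[OF f[unfolded One_nat_def] k inW[OF that]] by simp
      from mean_value_segment[OF this]
      have "\<exists>r\<in>closed_segment (y k) (g t k). f ((z k t)(k := g t k)) - f ((z k t)(k := y k))
          = (g t k - y k) * partial_deriv k f ((z k t)(k := r))" .
      moreover have "(z k t)(k := g t k) = z (Suc k) t" "(z k t)(k := y k) = z k t"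
        by (auto simp: z_def)
      ultimately have "\<exists>r. r \<in> closed_segment (y k) (g t k) \<and> f (z (Suc k) t) - f (z k t)
          = (g t k - y k) * partial_deriv k f ((z k t)(k := r))" by auto
      then have "s k t \<in> closed_segment (y k) (g t k) \<and> f (z (Suc k) t) - f (z k t)
          = (g t k - y k) * partial_deriv k f (\<xi> k t)"
        unfolding s_def \<xi>_def by (rule someI_ex)
      with inW show "\<xi> k t \<in> W \<and> s k t \<in> closed_segment (y k) (g t k) \<and>
        f (z (Suc k) t) - f (z k t) = (g t k - y k) * partial_deriv k f (\<xi> k t)"
        by (auto simp: \<xi>_def)
    qed
  qed
  \<comment> \<open>Here the continuity of the partial derivatives enters: \<open>\<xi> k t\<close>
    is squeezed to \<open>y\<close>.\<close>
  have pd: "((\<lambda>t. partial_deriv k f (\<xi> k t)) \<longlongrightarrow> partial_deriv k f y) (at t0)" if k: "k < n" for k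
  proof -
    have "\<forall>\<^sub>F t in at t0. \<forall>j. \<xi> k t j \<in> closed_segment (y j) (g t j)"
      using key by eventually_elim (use k in \<open>auto simp: \<xi>_def z_def\<close>)
    then have "(\<xi> k \<longlongrightarrow> y) (at t0)" by (rule tendsto_fun_between[OF lim])
    moreover have "\<forall>\<^sub>F t in at t0. \<xi> k t \<in> W"
      using key by eventually_elim (use k in auto)
    moreover have "continuous_on W (partial_deriv k f)"
      using f k by simp
    ultimately show ?thesis
      by (intro continuous_on_tendsto_compose[of W "partial_deriv k f" "\<xi> k" y])
        (use g0 in \<open>simp_all add: y_def\<close>)
  qed
  have "((\<lambda>t. \<Sum>k<n. (g t k - g t0 k) / (t - t0) * partial_deriv k f (\<xi> k t))
      \<longlongrightarrow> (\<Sum>k<n. d k * partial_deriv k f y)) (at t0)"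
    using d pd by (intro tendsto_sum tendsto_mult) (auto simp: has_field_derivative_iff)
  moreover have "\<forall>\<^sub>F t in at t0. (\<Sum>k<n. (g t k - g t0 k) / (t - t0) * partial_deriv k f (\<xi> k t))
      = (f (g t) - f (g t0)) / (t - t0)"
    using key gE
  proof eventually_elim
    case (elim t)
    have "z n t = g t"
      using elim(2) y0 by (auto simp: z_def topspace_Euclidean_space)
    moreover have "z 0 t = g t0" by (simp add: z_def y_def)
    ultimately have "f (g t) - f (g t0) = (\<Sum>k<n. f (z (Suc k) t) - f (z k t))"
      by (simp add: sum_lessThan_telescope[of "\<lambda>k. f (z k t)"])
    also have "\<dots> = (\<Sum>k<n. (g t k - y k) * partial_deriv k f (\<xi> k t))"
      using elim(1) by (intro sum.cong) auto
    finally show ?case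
      by (simp add: y_def sum_divide_distrib)
  qed
  ultimately show ?thesis
    unfolding has_field_derivative_iff y_def by (rule Lim_transform_eventually)
qed

section \<open>Charts and their coordinate lines\<close>

lemma openin_chart_image:
  assumes c: "is_chart n c" and V: "open V"
  shows "openin (Euclidean_space n) (snd c ` (fst c \<inter> V))"
proof -
  have "openin (subtopology (Euclidean_space n) (snd c ` fst c)) (snd c ` (fst c \<inter> V))"
    using c V homeomorphic_map_openness[of "top_of_set (fst c)" _ "snd c" "fst c \<inter> V"]
    by (auto simp: is_chart_def openin_open_Int)
  with c show ?thesis
    by (auto simp: is_chart_def intro: openin_trans_full)
qed

lemma chart_inv_chart:
  assumes "is_chart n c" "q \<in> fst c"
  shows "chart_inv c (snd c q) = q"
  using assms homeomorphic_imp_injective_map[of "top_of_set (fst c)" _ "snd c"]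
  by (auto simp: is_chart_def chart_inv_def inv_into_f_f)

lemma chart_in_Euclidean_space:
  assumes "is_chart n c" "q \<in> fst c"
  shows "snd c q \<in> topspace (Euclidean_space n)"
  using assms openin_subset[of "Euclidean_space n" "snd c ` fst c"] by (auto simp: is_chart_def)

lemma fun_upd_in_Euclidean_space:
  assumes "x \<in> topspace (Euclidean_space n)" "i < n"
  shows "x(i := t) \<in> topspace (Euclidean_space n)"
  using assms by (auto simp: topspace_Euclidean_space)

lemma tendsto_fun_upd:
  fixes x :: "'i \<Rightarrow> 'b::topological_space"
  shows "((\<lambda>t. x(i := t)) \<longlongrightarrow> x) (nhds (x i))"
proof (rule tendsto_fun_componentwise)
  fix j
  show "((\<lambda>t. (x(i := t)) j) \<longlongrightarrow> x j) (nhds (x i))"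
    by (cases "j = i") (auto simp: filterlim_ident)
qed

text \<open>The chart image is open only relative to \<open>Euclidean_space n\<close>, and changing
  a coordinate \<open>i < n\<close> does not leave that space. Thus partial derivatives at
  \<open>snd c p\<close> depend only on a function near \<open>p\<close>.\<close>

lemma eventually_chart_line:
  assumes c: "is_chart n c" and V: "open V" and p: "p \<in> fst c" "p \<in> V" and i: "i < n"
  shows "\<forall>\<^sub>F t in nhds (snd c p i). (snd c p)(i := t) \<in> snd c ` (fst c \<inter> V)"
proof -
  let ?x = "snd c p"
  obtain T where T: "open T" "snd c ` (fst c \<inter> V) = T \<inter> topspace (Euclidean_space n)"
    using openin_chart_image[OF c V]
    by (auto simp: Euclidean_space_def openin_subtopology euclidean_product_topology
        topspace_Euclidean_space)
  have "?x \<in> T" using T(2) p by auto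
  with tendsto_fun_upd[of ?x i] T(1) have "\<forall>\<^sub>F t in nhds (?x i). ?x(i := t) \<in> T"
    by (auto dest: topological_tendstoD)
  then show ?thesis
    by eventually_elim
      (use T(2) fun_upd_in_Euclidean_space[OF chart_in_Euclidean_space[OF c p(1)] i] in auto)
qed

section \<open>Coordinate vectors and the dimension of the tangent space\<close>

text \<open>The coordinate vector \<partial>/\<partial>x_i of the chart \<open>c\<close>, with the
  same cutoff as in \<open>tangent\<close>, so that tangent vectors are honest linear combinations
  of these functions.\<close>

definition chart_vec ::
  "('m::topological_space, 'r) smooth_mfd_scheme \<Rightarrow> 'm \<Rightarrow> 'm chart \<Rightarrow> nat \<Rightarrow> 'm tvec" where
  "chart_vec M p c i =
     (\<lambda>f. if smooth_near M p f then partial_deriv i (f \<circ> chart_inv c) (snd c p) else 0)"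

lemma scaleR_fun_apply: "(c *\<^sub>R f) x = c *\<^sub>R f x"
  by (simp add: scaleR_fun_def)

lemma sum_fun_apply: "(\<Sum>a\<in>A. f a) x = (\<Sum>a\<in>A. f a x)"
  by (induction A rule: infinite_finite_induct) auto

lemma tangent_eq_chart_vecs:
  "tangent M p = {\<Sum>i<mdim M. w i *\<^sub>R chart_vec M p c i | c w. c \<in> atlas M \<and> p \<in> fst c}"
proof -
  have "(\<Sum>i<mdim M. w i *\<^sub>R chart_vec M p c i) =
      (\<lambda>f. if smooth_near M p f
        then \<Sum>i<mdim M. w i * partial_deriv i (f \<circ> chart_inv c) (snd c p) else 0)" for c w
    by (auto simp: fun_eq_iff sum_fun_apply scaleR_fun_apply chart_vec_def)
  note eq = this
  show ?thesis
    unfolding tangent_def eq[symmetric] by blast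
qed

text \<open>The chain rule for a coordinate line of \<open>c\<close> read in the chart
  \<open>c'\<close>; the coefficients are a column of the Jacobian of the transition map. Hence
  \<open>tangent\<close>, by definition a union over charts, is spanned by the vectors of any one
  chart.\<close>

lemma chart_vec_transition:
  fixes M :: "('m::{t2_space,second_countable_topology}, 'r) smooth_mfd_scheme"
  assumes M: "smooth_manifold M" and c: "c \<in> atlas M" "p \<in> fst c"
    and c': "c' \<in> atlas M" "p \<in> fst c'" and i: "i < mdim M"
  shows "chart_vec M p c i = (\<Sum>j<mdim M.
    partial_deriv i (\<lambda>x. snd c' (chart_inv c x) j) (snd c p) *\<^sub>R chart_vec M p c' j)"
proof
  fix f
  let ?n = "mdim M" and ?x = "snd c p"
  have cc: "is_chart ?n c" "is_chart ?n c'"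
    using M c c' by (auto simp: smooth_manifold_def)
  have trans: "C_k_on 1 ?n (snd c ` (fst c \<inter> fst c')) (\<lambda>x. snd c' (chart_inv c x) j)" if "j < ?n" for j
    using M c c' that unfolding smooth_manifold_def smooth_on_def by blast
  show "chart_vec M p c i f = (\<Sum>j<?n.
      partial_deriv i (\<lambda>x. snd c' (chart_inv c x) j) ?x *\<^sub>R chart_vec M p c' j) f"
  proof (cases "smooth_near M p f")
    case True
    then obtain U where U: "open U" "p \<in> U" "smooth_fun M U f"
      by (auto simp: smooth_near_def)
    define W where "W = snd c' ` (fst c' \<inter> U)"
    \<comment> \<open>The \<open>i\<close>-th coordinate line of \<open>c\<close> through
      \<open>p\<close>, seen in the chart \<open>c'\<close>.\<close>
    define g where "g t = snd c' (chart_inv c (?x(i := t)))" for t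
    define d where "d j = partial_deriv i (\<lambda>x. snd c' (chart_inv c x) j) ?x" for j
    have "open (fst c')" using cc by (simp add: is_chart_def)
    then have ev: "\<forall>\<^sub>F t in nhds (?x i). ?x(i := t) \<in> snd c ` (fst c \<inter> (fst c' \<inter> U))"
      using c c' U by (intro eventually_chart_line[OF cc(1)]) (auto intro: i)
    have "C_k_on 1 ?n W (f \<circ> chart_inv c')"
      using U c' unfolding W_def smooth_fun_def smooth_on_def by blast
    moreover have "openin (Euclidean_space ?n) W"
      unfolding W_def by (rule openin_chart_image[OF cc(2) U(1)])
    moreover have "g (?x i) \<in> W"
      using c c' U by (auto simp: g_def W_def chart_inv_chart[OF cc(1)])
    moreover have "\<forall>\<^sub>F t in at (?x i). g t \<in> topspace (Euclidean_space ?n)"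
      by (rule eventually_mono[OF filter_leD[OF at_within_le_nhds ev]])
        (auto simp: g_def chart_inv_chart[OF cc(1)] intro: chart_in_Euclidean_space[OF cc(2)])
    moreover have "((\<lambda>t. g t j) has_field_derivative d j) (at (?x i))" if "j < ?n" for j
      using C_k_on_has_partial_deriv[OF trans[unfolded One_nat_def, OF that] i] c c'
      by (auto simp: g_def d_def)
    ultimately have "((\<lambda>t. (f \<circ> chart_inv c') (g t)) has_field_derivative
        (\<Sum>j<?n. d j * partial_deriv j (f \<circ> chart_inv c') (g (?x i)))) (at (?x i))"
      by (rule C_k_on_has_field_derivative_curve)
    \<comment> \<open>The two coordinate expressions of \<open>f\<close> agree along the line only
      while it stays in both chart domains, which is enough for the derivative.\<close>
    moreover have "\<forall>\<^sub>F t in nhds (?x i). (f \<circ> chart_inv c') (g t) = (f \<circ> chart_inv c) (?x(i := t))"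
      using ev by eventually_elim (auto simp: g_def chart_inv_chart[OF cc(1)] chart_inv_chart[OF cc(2)])
    ultimately have "((\<lambda>t. (f \<circ> chart_inv c) (?x(i := t))) has_field_derivative
        (\<Sum>j<?n. d j * partial_deriv j (f \<circ> chart_inv c') (g (?x i)))) (at (?x i))"
      by (rule iffD1[OF DERIV_cong_ev[OF refl _ refl], rotated])
    then have "partial_deriv i (f \<circ> chart_inv c) ?x =
        (\<Sum>j<?n. d j * partial_deriv j (f \<circ> chart_inv c') (g (?x i)))"
      by (simp add: partial_deriv_def DERIV_imp_deriv)
    moreover have "g (?x i) = snd c' p"
      using c by (simp add: g_def chart_inv_chart[OF cc(1)])
    ultimately show ?thesis
      using True by (simp add: chart_vec_def sum_fun_apply scaleR_fun_apply d_def)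
  qed (simp add: chart_vec_def sum_fun_apply scaleR_fun_apply)
qed

text \<open>Coordinate functions are smooth near \<open>p\<close> because the transition maps are
  smooth. The resulting duality yields the independence of the coordinate vectors.\<close>

lemma chart_vec_coordinate:
  fixes M :: "('m::{t2_space,second_countable_topology}, 'r) smooth_mfd_scheme"
  assumes M: "smooth_manifold M" and c: "c \<in> atlas M" "p \<in> fst c" and ij: "i < mdim M" "j < mdim M"
  shows "chart_vec M p c i (\<lambda>m. snd c m j) = (if i = j then 1 else 0)"
proof -
  let ?x = "snd c p"
  have cc: "is_chart (mdim M) c" using M c by (auto simp: smooth_manifold_def)
  have "smooth_fun M (fst c) (\<lambda>m. snd c m j)"
    using M c ij by (simp add: smooth_manifold_def smooth_fun_def o_def)
  then have near: "smooth_near M p (\<lambda>m. snd c m j)"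
    using c cc by (auto simp: smooth_near_def is_chart_def)
  have "\<forall>\<^sub>F t in nhds (?x i). ?x(i := t) \<in> snd c ` (fst c \<inter> UNIV)"
    using c ij by (intro eventually_chart_line[OF cc]) auto
  then have ev: "\<forall>\<^sub>F t in nhds (?x i). ((\<lambda>m. snd c m j) \<circ> chart_inv c) (?x(i := t)) = (?x(i := t)) j"
    by eventually_elim (auto simp: chart_inv_chart[OF cc] simp del: fun_upd_apply)
  have "((\<lambda>t. (?x(i := t)) j) has_field_derivative (if i = j then 1 else 0)) (at (?x i))"
    by (auto intro!: derivative_eq_intros)
  then have "((\<lambda>t. ((\<lambda>m. snd c m j) \<circ> chart_inv c) (?x(i := t))) has_field_derivative
      (if i = j then 1 else 0)) (at (?x i))"
    using DERIV_cong_ev[OF refl ev refl] by blast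
  with near show ?thesis
    by (simp add: chart_vec_def partial_deriv_def DERIV_imp_deriv)
qed

text \<open>Evaluation on coordinate functions gives independence, the change of charts gives the
  span. The cardinality later determines the dimension of the Samelson subalgebras.\<close>

lemma tangent_basis:
  fixes M :: "('m::{t2_space,second_countable_topology}, 'r) smooth_mfd_scheme"
  assumes M: "smooth_manifold M"
  obtains B where "finite B" "card B = mdim M" "independent B" "span B = tangent M p"
proof -
  let ?n = "mdim M"
  have "p \<in> \<Union> (fst ` atlas M)"
    using M by (simp add: smooth_manifold_def)
  then obtain c where c: "c \<in> atlas M" "p \<in> fst c"
    by (rule UN_E)
  define e where "e = chart_vec M p c"
  define x where "x j = (\<lambda>m. snd c m j)" for j
  have coord: "e i (x j) = (if i = j then 1 else 0)" if "i < ?n" "j < ?n" for i j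
    unfolding e_def x_def by (rule chart_vec_coordinate[OF M c that])
  have inj: "inj_on e {..<?n}"
  proof (rule inj_onI)
    fix i j assume ij: "i \<in> {..<?n}" "j \<in> {..<?n}" and eq: "e i = e j"
    from eq have "e i (x i) = e j (x i)"
      by (rule fun_cong)
    with ij show "i = j" by (simp add: coord split: if_splits)
  qed
  have ind: "independent (e ` {..<?n})"
  proof
    assume "dependent (e ` {..<?n})"
    then obtain u v where sum: "(\<Sum>b\<in>e ` {..<?n}. u b *\<^sub>R b) = 0"
      and v: "v \<in> e ` {..<?n}" "u v \<noteq> 0"
      by (auto simp: dependent_finite)
    then obtain j where j: "j < ?n" "v = e j" by auto
    have "(\<Sum>i<?n. u (e i) *\<^sub>R e i) = 0"
      using sum by (simp only: sum.reindex[OF inj] o_def)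
    then have "(\<Sum>i<?n. u (e i) *\<^sub>R e i) (x j) = 0"
      by (simp only: zero_fun_def)
    then have "(\<Sum>i<?n. u (e i) * e i (x j)) = 0"
      by (simp only: sum_fun_apply scaleR_fun_apply real_scaleR_def)
    moreover have "(\<Sum>i<?n. u (e i) * e i (x j)) = (\<Sum>i<?n. if i = j then u v else 0)"
      by (intro sum.cong refl) (simp add: coord j)
    ultimately show False using j(1) v(2) by simp
  qed
  have e: "e i \<in> span (e ` {..<?n})" if "i < ?n" for i
    using that by (intro span_base) simp
  have "chart_vec M p c' i \<in> span (e ` {..<?n})" if "c' \<in> atlas M" "p \<in> fst c'" "i < ?n" for c' i
    unfolding chart_vec_transition[OF M that(1,2) c that(3)]
    by (auto intro!: span_sum span_scale e simp flip: e_def)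
  then have "tangent M p \<subseteq> span (e ` {..<?n})"
    by (auto simp: tangent_eq_chart_vecs intro!: span_sum span_scale)
  moreover have "span (e ` {..<?n}) \<subseteq> tangent M p"
  proof
    fix v assume "v \<in> span (e ` {..<?n})"
    then obtain u where "v = (\<Sum>x\<in>e ` {..<?n}. u x *\<^sub>R x)"
      by (auto simp: span_finite)
    then have "v = (\<Sum>i<?n. (u \<circ> e) i *\<^sub>R chart_vec M p c i)"
      by (simp add: sum.reindex[OF inj] flip: e_def)
    with c show "v \<in> tangent M p"
      unfolding tangent_eq_chart_vecs by blast
  qed
  ultimately show thesis
    using ind by (intro that[of "e ` {..<?n}"]) (auto simp: card_image[OF inj])
qed

lemma subspace_tangent:
  fixes M :: "('m::{t2_space,second_countable_topology}, 'r) smooth_mfd_scheme"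
  assumes "smooth_manifold M"
  shows "subspace (tangent M p)"
  by (rule tangent_basis[OF assms, of p]) (metis subspace_span)

section \<open>Complex structures on real vector spaces\<close>

text \<open>If a new element \<open>b\<close> were \<open>x + y\<close> with \<open>x\<close> in the
  span of \<open>A\<close> and \<open>y\<close> in that of \<open>F\<close>, then
  \<open>x = b - y\<close> would lie in both spans and vanish, putting \<open>b\<close> into the
  span of \<open>F\<close>.\<close>

lemma (in vector_space) independent_Un:
  assumes "independent A" "finite B" "independent B" "span A \<inter> span B \<subseteq> {0}"
  shows "independent (A \<union> B)"
  using assms(2-4)
proof (induction B rule: finite_induct)
  case (insert b F)
  have sub: "span F \<subseteq> span (insert b F)"
    by (intro span_mono) auto
  from insert have F: "independent F" "b \<notin> span F"
    by (auto simp: independent_insert)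
  have "b \<notin> span (A \<union> F)"
  proof
    assume "b \<in> span (A \<union> F)"
    then obtain x y where xy: "b = x + y" "x \<in> span A" "y \<in> span F"
      by (auto simp: span_Un)
    then have "x = b - y" by simp
    with xy sub have "x \<in> span (insert b F)"
      by (auto intro: span_diff span_base)
    with insert.prems xy have "x = 0" by blast
    with xy F show False by simp
  qed
  moreover have "independent (A \<union> F)"
    using insert F sub by blast
  ultimately show ?case
    by (simp add: independent_insertI)
qed (use assms(1) in simp)

section \<open>Bases of complexifications and conjugation\<close>

lemmas cplx_ops = zero_cplx_def plus_cplx_def uminus_cplx_def minus_cplx_def cscale_def

lemma re_sum: "re (\<Sum>a\<in>A. f a) = (\<Sum>a\<in>A. re (f a))"
  by (induction A rule: infinite_finite_induct) (auto simp: cplx_ops)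

lemma im_sum: "im (\<Sum>a\<in>A. f a) = (\<Sum>a\<in>A. im (f a))"
  by (induction A rule: infinite_finite_induct) (auto simp: cplx_ops)

lemma conj_cplx_simps [simp]:
  "re (conj_cplx x) = re x" "im (conj_cplx x) = - im x" "conj_cplx (conj_cplx x) = (x::'a::ab_group_add cplx)"
  by (simp_all add: conj_cplx_def)

lemma of_re_simps [simp]: "re (of_re u) = u" "im (of_re u) = 0"
  by (simp_all add: of_re_def)

lemma subspace_complexify: "subspace V \<Longrightarrow> cx.subspace (complexify V)"
  by (auto simp: cx.subspace_def complexify_def cplx_ops subspace_0 subspace_add subspace_diff
      subspace_scale)

lemma cplx_eq_of_re: "x = of_re (re x) + cscale \<i> (of_re (im x))"
  by (simp add: cplx_ops of_re_def)

lemma of_re_span: "u \<in> span B \<Longrightarrow> of_re u \<in> cx.span (of_re ` B)"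
proof (induction rule: span_induct_alt)
  case base
  show ?case using cx.span_zero by (simp add: of_re_def zero_cplx_def)
next
  case (step c x y)
  have "of_re (c *\<^sub>R x + y) = cscale (of_real c) (of_re x) + of_re y"
    by (simp add: of_re_def cplx_ops)
  with step show ?case
    by (auto intro: cx.span_add cx.span_scale cx.span_base)
qed

lemma complexify_span: "complexify (span B) = cx.span (of_re ` B)"
proof
  show "complexify (span B) \<subseteq> cx.span (of_re ` B)"
  proof
    fix x assume "x \<in> complexify (span B)"
    then have "of_re (re x) + cscale \<i> (of_re (im x)) \<in> cx.span (of_re ` B)"
      by (intro cx.span_add cx.span_scale of_re_span) (auto simp: complexify_def)
    then show "x \<in> cx.span (of_re ` B)"
      by (simp flip: cplx_eq_of_re)
  qed
  show "cx.span (of_re ` B) \<subseteq> complexify (span B)"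
    by (intro cx.span_minimal subspace_complexify subspace_span)
      (auto simp: complexify_def of_re_def span_base span_zero)
qed

text \<open>The real and imaginary parts of a complex relation between real vectors are two real
  relations.\<close>

lemma independent_of_re:
  assumes fin: "finite B" and B: "independent B"
  shows "cx.independent (of_re ` B)"
proof (rule cx.independent_if_scalars_zero)
  have inj: "inj_on of_re B" by (auto simp: inj_on_def of_re_def)
  fix z x assume sum: "(\<Sum>x\<in>of_re ` B. cscale (z x) x) = 0" and "x \<in> of_re ` B"
  then obtain b where b: "b \<in> B" "x = of_re b" by auto
  have eq: "(\<Sum>b\<in>B. cscale (z (of_re b)) (of_re b)) = 0"
    using sum by (simp add: sum.reindex[OF inj])
  have "(\<Sum>b\<in>B. Re (z (of_re b)) *\<^sub>R b) = 0" "(\<Sum>b\<in>B. Im (z (of_re b)) *\<^sub>R b) = 0"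
    using arg_cong[OF eq, of re] arg_cong[OF eq, of im]
    by (simp_all add: re_sum im_sum) (simp_all add: cplx_ops of_re_def)
  then have "Re (z (of_re b)) = 0" "Im (z (of_re b)) = 0"
    using independentD[OF B fin order_refl _ b(1), of "\<lambda>b. Re (z (of_re b))"]
      independentD[OF B fin order_refl _ b(1), of "\<lambda>b. Im (z (of_re b))"] by auto
  then show "z x = 0" by (simp add: b complex_eq_iff)
qed (use fin in simp)

lemma dim_complexify_span:
  assumes "finite B" "independent B"
  shows "cx.dim (complexify (span B)) = card B"
proof -
  have "inj_on of_re B" by (auto simp: inj_on_def of_re_def)
  then show ?thesis
    unfolding complexify_span using cx.dim_span_eq_card_independent[OF independent_of_re[OF assms]]
    by (simp add: card_image)
qed

text \<open>Conjugation is only antilinear: scalars turn into their conjugates, which still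
  preserves spans.\<close>

lemma conj_cplx_span: "x \<in> cx.span C \<Longrightarrow> conj_cplx x \<in> cx.span (conj_cplx ` C)"
proof (induction rule: cx.span_induct_alt)
  case base
  show ?case using cx.span_zero by (simp add: conj_cplx_def zero_cplx_def)
next
  case (step c x y)
  have "conj_cplx (cscale c x + y) = cscale (cnj c) (conj_cplx x) + conj_cplx y"
    by (simp add: conj_cplx_def cplx_ops)
  with step show ?case
    by (auto intro: cx.span_add cx.span_scale cx.span_base)
qed

lemma independent_conj_cplx:
  assumes "cx.independent C"
  shows "cx.independent (conj_cplx ` C)"
proof
  assume "cx.dependent (conj_cplx ` C)"
  then obtain c where c: "c \<in> C" "conj_cplx c \<in> cx.span (conj_cplx ` C - {conj_cplx c})"
    by (auto simp: cx.dependent_def)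
  have "conj_cplx ` (conj_cplx ` C - {conj_cplx c}) \<subseteq> C - {c}"
    by (auto simp: image_iff)
  then have "c \<in> cx.span (C - {c})"
    using subsetD[OF cx.span_mono conj_cplx_span[OF c(2)]] by simp
  with c assms show False by (auto simp: cx.dependent_def)
qed

section \<open>Complex structures and their \<open>i\<close>-eigenspaces\<close>

definition complex_structure_on :: "'a::real_vector set \<Rightarrow> ('a \<Rightarrow> 'a) \<Rightarrow> bool" where
  "complex_structure_on V I \<longleftrightarrow> linear_on V I \<and> I ` V \<subseteq> V \<and> (\<forall>a\<in>V. I (I a) = - a)"

text \<open>For \<open>V = liek K\<close> this is the set that \<open>samelson\<close> prescribes
  for \<open>l\<close>, as \<open>lieg K\<close> is \<open>complexify (liek K)\<close>.\<close>

definition eigenspace_i :: "'a::real_vector set \<Rightarrow> ('a \<Rightarrow> 'a) \<Rightarrow> 'a cplx set" where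
  "eigenspace_i V I = {x \<in> complexify V. cext I x = cscale \<i> x}"

lemma linear_on_add: "linear_on V f \<Longrightarrow> u \<in> V \<Longrightarrow> v \<in> V \<Longrightarrow> f (u + v) = f u + f v"
  by (simp add: linear_on_def)

lemma linear_on_scale: "linear_on V f \<Longrightarrow> u \<in> V \<Longrightarrow> f (c *\<^sub>R u) = c *\<^sub>R f u"
  by (simp add: linear_on_def)

lemma linear_on_minus: "linear_on V f \<Longrightarrow> u \<in> V \<Longrightarrow> f (- u) = - f u"
  using linear_on_scale[of V f u "-1"] by simp

lemma linear_on_diff:
  assumes "linear_on V f" "subspace V" "u \<in> V" "v \<in> V"
  shows "f (u - v) = f u - f v"
  using linear_on_add[OF assms(1,3), of "- v"] linear_on_minus[OF assms(1,4)] assms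
  by (simp add: subspace_neg)

lemma complex_structure_onD:
  assumes "complex_structure_on V I" "u \<in> V"
  shows "I u \<in> V" "I (I u) = - u"
  using assms by (auto simp: complex_structure_on_def)

text \<open>The eigenvectors are exactly the \<open>u - i I u\<close>: of the two real equations
  \<open>I u = - v\<close> and \<open>I v = u\<close> for \<open>u + i v\<close>, the first implies
  the second by \<open>I (I u) = - u\<close>.\<close>

lemma eigenspace_i_iff:
  assumes "complex_structure_on V I" "subspace V"
  shows "x \<in> eigenspace_i V I \<longleftrightarrow> re x \<in> V \<and> im x = - I (re x)"
proof -
  have "linear_on V I" using assms by (simp add: complex_structure_on_def)
  then have "I (- I u) = u" if "u \<in> V" for u
    using complex_structure_onD[OF assms(1)] linear_on_minus that by (metis minus_minus)
  then show ?thesis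
    using assms complex_structure_onD[OF assms(1)]
    by (auto simp: eigenspace_i_def complexify_def cext_def cscale_def subspace_neg)
qed

lemma complex_structure_on_uminus:
  assumes "complex_structure_on V I" "subspace V"
  shows "complex_structure_on V (\<lambda>u. - I u)"
  using assms linear_on_minus[of V I]
  by (auto simp: complex_structure_on_def linear_on_def image_subset_iff subspace_neg)

text \<open>Conjugation takes \<open>u - i I u\<close> to \<open>u + i I u\<close>. This is how a
  sign change of the complex structure becomes the conjugate subalgebra in
  \<open>Lm\<close>.\<close>

lemma conj_cplx_eigenspace_i:
  assumes "complex_structure_on V I" "subspace V"
  shows "conj_cplx ` eigenspace_i V I = eigenspace_i V (\<lambda>u. - I u)"
proof -
  note iff = eigenspace_i_iff[OF assms]
    eigenspace_i_iff[OF complex_structure_on_uminus[OF assms] assms(2)]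
  show ?thesis
  proof
    show "conj_cplx ` eigenspace_i V I \<subseteq> eigenspace_i V (\<lambda>u. - I u)"
      by (auto simp: iff)
    show "eigenspace_i V (\<lambda>u. - I u) \<subseteq> conj_cplx ` eigenspace_i V I"
      by (rule subsetI, rule image_eqI[of _ _ "conj_cplx _"]) (auto simp: iff)
  qed
qed

lemma subspace_eigenspace_i:
  assumes "complex_structure_on V I" "subspace V"
  shows "cx.subspace (eigenspace_i V I)"
proof -
  have lin: "linear_on V I" using assms by (simp add: complex_structure_on_def)
  have "I 0 = 0" using linear_on_scale[OF lin, of 0 0] assms(2) by (simp add: subspace_0)
  then show ?thesis
    using assms(2) complex_structure_onD[OF assms(1)]
    by (auto simp: cx.subspace_def eigenspace_i_iff[OF assms] cplx_ops subspace_0 subspace_add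
        subspace_scale subspace_diff subspace_neg linear_on_add[OF lin] linear_on_scale[OF lin] linear_on_diff[OF lin assms(2)])
qed

text \<open>The complexification is the direct sum of the eigenspace and its conjugate, so a basis
  \<open>C\<close> of the eigenspace together with the conjugates of its elements is a basis of
  \<open>complexify V\<close>.\<close>

lemma dim_eigenspace_i:
  assumes I: "complex_structure_on V I" and B: "finite B" "independent B" "span B = V"
  shows "2 * cx.dim (eigenspace_i V I) = card B"
proof -
  have V: "subspace V" using B by auto
  have lin: "linear_on V I" using I by (simp add: complex_structure_on_def)
  note mem = complex_structure_onD[OF I]
  define l where "l = eigenspace_i V I"
  note l_iff = eigenspace_i_iff[OF I V, folded l_def]
  have l: "cx.subspace l" unfolding l_def by (rule subspace_eigenspace_i[OF I V])
  obtain C where C: "C \<subseteq> l" "cx.independent C" "l \<subseteq> cx.span C" "card C = cx.dim l"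
    by (rule cx.basis_exists)
  have spanC: "cx.span C = l"
    using C l cx.span_minimal by blast
  have conjl: "cx.span (conj_cplx ` C) = conj_cplx ` l"
  proof
    show "cx.span (conj_cplx ` C) \<subseteq> conj_cplx ` l"
      using C unfolding l_def conj_cplx_eigenspace_i[OF I V]
      by (intro cx.span_minimal subspace_eigenspace_i complex_structure_on_uminus I V)
        (auto simp flip: conj_cplx_eigenspace_i[OF I V])
    show "conj_cplx ` l \<subseteq> cx.span (conj_cplx ` C)"
      using spanC conj_cplx_span by blast
  qed
  have sub: "l \<subseteq> complexify V"
    by (auto simp: l_def eigenspace_i_def)
  \<comment> \<open>Counting with \<open>card\<close> is meaningful only for finite
    \<open>C\<close>; the bound comes from the finite spanning set of real basis vectors.\<close>
  have "finite C"
    using cx.independent_span_bound[OF _ C(2), of "of_re ` B"] B(1) C(1) sub complexify_span[of B] B(3)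
    by auto
  \<comment> \<open>A common element has imaginary part both \<open>- I (re x)\<close> and
    \<open>I (re x)\<close>.\<close>
  have 0: "l \<inter> conj_cplx ` l \<subseteq> {0}"
  proof
    fix x assume "x \<in> l \<inter> conj_cplx ` l"
    then have x: "re x \<in> V" "im x = - I (re x)" "im x = I (re x)"
      unfolding l_def conj_cplx_eigenspace_i[OF I V]
      by (auto simp: eigenspace_i_iff complex_structure_on_uminus I V)
    then have "(2::real) *\<^sub>R I (re x) = 0" by (metis add.right_inverse scaleR_2)
    then have "I (re x) = 0" by simp
    moreover from this have "re x = 0"
      using mem(2)[OF x(1)] linear_on_scale[OF lin, of 0 0] V by (simp add: subspace_0)
    ultimately show "x \<in> {0}"
      using x by (cases x) (simp add: zero_cplx_def)
  qed
  have ind: "cx.independent (C \<union> conj_cplx ` C)"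
    using \<open>finite C\<close> 0 by (intro cx.independent_Un C independent_conj_cplx) (auto simp: spanC conjl)
  have "0 \<notin> C"
    using C(2) cx.dependent_zero by auto
  have "C \<inter> conj_cplx ` C = {}"
  proof (rule equals0I)
    fix c assume c: "c \<in> C \<inter> conj_cplx ` C"
    have "C \<inter> conj_cplx ` C \<subseteq> l \<inter> conj_cplx ` l"
      by (intro Int_mono image_mono C(1))
    with c 0 have "c = 0" by (auto dest!: subsetD)
    with c \<open>0 \<notin> C\<close> show False by simp
  qed
  then have card: "card (C \<union> conj_cplx ` C) = 2 * card C"
    using \<open>finite C\<close> inj_on_inverseI[of C conj_cplx conj_cplx]
    by (simp add: card_Un_disjoint card_image)
  have "complexify V \<subseteq> cx.span (C \<union> conj_cplx ` C)"
  proof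
    fix x assume x: "x \<in> complexify V"
    define u v where "u = re x" and "v = im x"
    have uv: "u \<in> V" "v \<in> V" using x by (auto simp: u_def v_def complexify_def)
    \<comment> \<open>\<open>a\<close> is the projection \<open>(x - i I x) / 2\<close> to
      \<open>l\<close>, and \<open>b\<close> is the conjugate of the complementary projection
      \<open>(x + i I x) / 2\<close>.\<close>
    define a where "a = Cplx ((1/2) *\<^sub>R (u + I v)) ((1/2) *\<^sub>R (v - I u))"
    define b where "b = Cplx ((1/2) *\<^sub>R (u - I v)) (- ((1/2) *\<^sub>R (v + I u)))"
    have "a \<in> l"
      using uv V mem by (auto simp: a_def l_iff linear_on_add[OF lin] linear_on_scale[OF lin] subspace_add subspace_scale
          scaleR_right_diff_distrib)
    moreover have "b \<in> l"
      using uv V mem by (auto simp: b_def l_iff linear_on_add[OF lin] linear_on_scale[OF lin] linear_on_diff[OF lin V]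
          subspace_diff subspace_scale scaleR_right_distrib add.commute)
    moreover have "x = a + conj_cplx b"
    proof -
      have half: "(1/2) *\<^sub>R w + (1/2) *\<^sub>R w = w" for w :: 'a
        by (simp flip: scaleR_left_distrib)
      have "(1/2) *\<^sub>R (u + I v) + (1/2) *\<^sub>R (u - I v) = u"
        "(1/2) *\<^sub>R (v - I u) + (1/2) *\<^sub>R (v + I u) = v"
        using half[of u] half[of v] by (simp_all flip: scaleR_right_distrib)
      then show ?thesis
        by (simp add: a_def b_def plus_cplx_def conj_cplx_def u_def v_def)
    qed
    ultimately show "x \<in> cx.span (C \<union> conj_cplx ` C)"
      unfolding cx.span_Un conjl spanC by blast
  qed
  moreover have "C \<union> conj_cplx ` C \<subseteq> complexify V"
    using C(1) sub V by (auto simp: complexify_def subspace_neg)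
  ultimately have "cx.dim (complexify V) = card (C \<union> conj_cplx ` C)"
    using ind by (intro cx.dim_unique) auto
  with card C(4) dim_complexify_span[OF B(1,2)] B(3) show ?thesis
    by (simp add: l_def)
qed

section \<open>The splitting of a generalized Kaehler structure\<close>

text \<open>For a Riemannian \<open>g\<close> and \<open>s = 1\<close> or \<open>s = - 1\<close>,
  the image of the tangent space is the \<open>s\<close>-eigenspace of the map sending
  \<open>(v, \<xi>)\<close> to \<open>(sharp \<xi>, flat v)\<close>. The parameter \<open>s\<close>
  allows both signs to be treated at once.\<close>

definition metric_graph ::
  "('m::topological_space, 'r) smooth_mfd_scheme \<Rightarrow> 'm metric \<Rightarrow> 'm \<Rightarrow> real \<Rightarrow> 'm tvec \<Rightarrow> 'm gvec" where
  "metric_graph M g p s u = (u, s *\<^sub>R flat M g p u)"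

lemma subspace_cotangent: "subspace (cotangent M p)"
  by (auto simp: subspace_def cotangent_def linear_on_def scaleR_fun_apply algebra_simps)

lemma subspace_gtangent:
  fixes M :: "('m::{t2_space,second_countable_topology}, 'r) smooth_mfd_scheme"
  assumes "smooth_manifold M"
  shows "subspace (gtangent M p)"
  unfolding gtangent_def by (intro subspace_Times subspace_tangent assms subspace_cotangent)

section \<open>The graphs of a metric and of its negative\<close>

context
  fixes M :: "('m::{t2_space,second_countable_topology}, 'r) smooth_mfd_scheme"
    and g :: "'m metric" and p :: 'm
  assumes M: "smooth_manifold M" and g: "riemannian_metric M g"
begin

lemma metric_sym: "u \<in> tangent M p \<Longrightarrow> v \<in> tangent M p \<Longrightarrow> g p u v = g p v u"
  using g by (simp add: riemannian_metric_def)

lemma linear_on_metric: "w \<in> tangent M p \<Longrightarrow> linear_on (tangent M p) (\<lambda>u. g p u w)"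
  using g by (simp add: riemannian_metric_def bilinear_on_def)

lemma metric_linear:
  assumes "u \<in> tangent M p" "v \<in> tangent M p"
  shows "w \<in> tangent M p \<Longrightarrow> g p (u + v) w = g p u w + g p v w"
    and "w \<in> tangent M p \<Longrightarrow> g p (u - v) w = g p u w - g p v w"
    and "g p (c *\<^sub>R u) v = c * g p u v"
    and "g p (- u) v = - g p u v"
    and "g p u (- v) = - g p u v"
proof -
  note lin = linear_on_metric
  show "g p (u + v) w = g p u w + g p v w" if "w \<in> tangent M p"
    using linear_on_add[OF lin[OF that]] assms by simp
  show "g p (u - v) w = g p u w - g p v w" if "w \<in> tangent M p"
    using linear_on_diff[OF lin[OF that] subspace_tangent[OF M]] assms by simp
  show "g p (c *\<^sub>R u) v = c * g p u v"
    using linear_on_scale[OF lin[OF assms(2)]] assms by simp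
  show "g p (- u) v = - g p u v"
    using linear_on_minus[OF lin[OF assms(2)]] assms by simp
  have "- v \<in> tangent M p"
    using assms subspace_tangent[OF M] by (simp add: subspace_neg)
  then show "g p u (- v) = - g p u v"
    using linear_on_minus[OF lin[OF assms(1)] assms(2)] assms
    by (simp add: metric_sym[of u])
qed

lemma flat_linear:
  assumes "u \<in> tangent M p" "v \<in> tangent M p"
  shows "flat M g p (u + v) = flat M g p u + flat M g p v"
    "flat M g p (c *\<^sub>R u) = c *\<^sub>R flat M g p u"
    "flat M g p (u - v) = flat M g p u - flat M g p v"
  using assms by (auto simp: flat_def fun_eq_iff metric_linear scaleR_fun_apply)

text \<open>Positive definiteness, tested on \<open>u - v\<close>.\<close>

lemma inj_on_flat: "inj_on (flat M g p) (tangent M p)"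
proof (rule inj_onI)
  fix u v assume uv: "u \<in> tangent M p" "v \<in> tangent M p" "flat M g p u = flat M g p v"
  then have d: "u - v \<in> tangent M p"
    using subspace_tangent[OF M] by (simp add: subspace_diff)
  have "flat M g p u (u - v) = flat M g p v (u - v)"
    using uv(3) by (rule fun_cong)
  then have "g p (u - v) (u - v) = 0"
    using uv d by (simp add: flat_def metric_linear)
  then have "u - v = 0"
    using g d unfolding riemannian_metric_def by (metis less_irrefl)
  then show "u = v" by simp
qed

lemma flat_in_cotangent: "u \<in> tangent M p \<Longrightarrow> flat M g p u \<in> cotangent M p"
  using metric_linear subspace_tangent[OF M, of p] g
  by (auto simp: cotangent_def flat_def linear_on_def riemannian_metric_def bilinear_on_def
      subspace_add subspace_scale)

lemma sharp_flat: "u \<in> tangent M p \<Longrightarrow> sharp M g p (flat M g p u) = u"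
  by (simp add: sharp_def inv_into_f_f[OF inj_on_flat])

lemma metric_graph_in_gtangent:
  "u \<in> tangent M p \<Longrightarrow> metric_graph M g p s u \<in> gtangent M p"
  by (simp add: metric_graph_def gtangent_def flat_in_cotangent subspace_scale[OF subspace_cotangent])

lemma linear_on_metric_graph: "linear_on (tangent M p) (metric_graph M g p s)"
  by (auto simp: linear_on_def metric_graph_def flat_linear scaleR_right_distrib mult.commute)

text \<open>The vector component determines \<open>u - v\<close>, and the covector component,
  \<open>flat\<close> being injective, determines \<open>u + v\<close>.\<close>

lemma metric_graphs_independent:
  assumes V: "u \<in> tangent M p" "v \<in> tangent M p" "u' \<in> tangent M p" "v' \<in> tangent M p"
    and eq: "metric_graph M g p 1 u - metric_graph M g p (- 1) v
      = metric_graph M g p 1 u' - metric_graph M g p (- 1) v'"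
  shows "u = u'" "v = v'"
proof -
  have "u - v = u' - v'" "flat M g p (u + v) = flat M g p (u' + v')"
    using eq V by (simp_all add: metric_graph_def flat_linear)
  moreover from this have "u + v = u' + v'"
    using inj_onD[OF inj_on_flat] V subspace_tangent[OF M, of p] by (simp add: subspace_add)
  ultimately have "(u - v) + (u + v) = (u' - v') + (u' + v')" "(u + v) - (u - v) = (u' + v') - (u' - v')"
    by simp_all
  then have "2 *\<^sub>R u = 2 *\<^sub>R u'" "2 *\<^sub>R v = 2 *\<^sub>R v'"
    by (simp_all add: scaleR_2)
  then show "u = u'" "v = v'" by simp_all
qed

lemma pairing_metric_graph:
  assumes "u \<in> tangent M p" "v \<in> tangent M p"
  shows "pairing (metric_graph M g p s u) (metric_graph M g p s v) = s * g p u v"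
  using assms metric_sym[of v u]
  by (simp add: pairing_def metric_graph_def flat_def scaleR_fun_apply)

text \<open>\<open>Jp\<close> commutes with \<open>- Jp Jm\<close> and so preserves its
  \<open>s\<close>-eigenspace, the graph of \<open>s g\<close>; projecting to the tangent space
  turns \<open>Jp\<close> into \<open>I\<close>. The pairing restricts to \<open>s g\<close> on this
  graph, so orthogonality of \<open>Jp\<close> makes \<open>I\<close> an isometry of
  \<open>g\<close>.\<close>

lemma gen_kahler_metric_graph:
  assumes J: "gen_kahler M \<gamma> Jp Jm g" and s: "s * s = 1"
  obtains I where "complex_structure_on (tangent M p) I"
    and "\<And>u v. u \<in> tangent M p \<Longrightarrow> v \<in> tangent M p \<Longrightarrow> g p (I u) (I v) = g p u v"
    and "\<And>u. u \<in> tangent M p \<Longrightarrow> Jp p (metric_graph M g p s u) = metric_graph M g p s (I u)"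
    and "\<And>u. u \<in> tangent M p \<Longrightarrow> Jm p (metric_graph M g p s u) = metric_graph M g p s (s *\<^sub>R I u)"
proof -
  let ?V = "tangent M p" and ?E = "gtangent M p"
  define F where "F = flat M g p"
  define C where "C = metric_graph M g p s"
  have s0: "s \<noteq> 0" using s by auto
  have lin: "linear_on ?E (Jp p)" "linear_on ?E (Jm p)"
    and inE: "\<And>x. x \<in> ?E \<Longrightarrow> Jp p x \<in> ?E" "\<And>x. x \<in> ?E \<Longrightarrow> Jm p x \<in> ?E"
    and sq: "\<And>x. x \<in> ?E \<Longrightarrow> Jp p (Jp p x) = - x"
    and orth: "\<And>x y. x \<in> ?E \<Longrightarrow> y \<in> ?E \<Longrightarrow> pairing (Jp p x) (Jp p y) = pairing x y"
    and comm: "\<And>x. x \<in> ?E \<Longrightarrow> Jp p (Jm p x) = Jm p (Jp p x)"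
    using J by (simp_all add: gen_kahler_def gen_complex_def image_subset_iff)
  have G: "- Jp p (Jm p (v, \<xi>)) = (sharp M g p \<xi>, F v)" if "v \<in> ?V" "\<xi> \<in> cotangent M p" for v \<xi>
    using J that by (simp add: gen_kahler_def F_def)
  have CE: "C u \<in> ?E" if "u \<in> ?V" for u
    unfolding C_def by (rule metric_graph_in_gtangent[OF that])
  have linC: "linear_on ?V C"
    unfolding C_def by (rule linear_on_metric_graph)
  \<comment> \<open>The graph consists of eigenvectors; \<open>s * s = 1\<close> takes care of the
    covector component.\<close>
  have GC: "- Jp p (Jm p (C u)) = s *\<^sub>R C u" if "u \<in> ?V" for u
  proof -
    have "sharp M g p (s *\<^sub>R F u) = s *\<^sub>R u"
      using that sharp_flat[of "s *\<^sub>R u"] subspace_tangent[OF M]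
      by (simp add: F_def flat_linear subspace_scale)
    then show ?thesis
      using G[of u "s *\<^sub>R F u"] that s
      by (simp add: C_def metric_graph_def F_def flat_in_cotangent
          subspace_scale[OF subspace_cotangent])
  qed
  \<comment> \<open>Conversely, an eigenvector lies on the graph: its covector component is
    recovered by multiplying the eigenvalue equation by \<open>s\<close>.\<close>
  have CG: "x = C (fst x)" if x: "x \<in> ?E" "- Jp p (Jm p x) = s *\<^sub>R x" for x
  proof -
    have "s *\<^sub>R x = (sharp M g p (snd x), F (fst x))"
      using G[of "fst x" "snd x"] x by (auto simp: gtangent_def)
    then have "s *\<^sub>R (s *\<^sub>R snd x) = s *\<^sub>R F (fst x)"
      by (metis snd_conv snd_scaleR)
    then show ?thesis
      by (simp add: C_def metric_graph_def F_def s prod_eq_iff)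
  qed
  define I where "I u = fst (Jp p (C u))" for u
  have JpC: "Jp p (C u) = C (I u)" if u: "u \<in> ?V" for u
  proof -
    have "- Jp p (Jm p (Jp p (C u))) = Jp p (- Jp p (Jm p (C u)))"
      using CE[OF u] inE comm by (simp add: linear_on_minus[OF lin(1)])
    also have "\<dots> = s *\<^sub>R Jp p (C u)"
      using CE[OF u] by (simp add: GC[OF u] linear_on_scale[OF lin(1)])
    finally show ?thesis
      unfolding I_def by (intro CG inE CE u)
  qed
  have IV: "I u \<in> ?V" if "u \<in> ?V" for u
    using inE(1)[OF CE[OF that]] by (auto simp: I_def gtangent_def)
  have fstC: "fst (C u) = u" for u
    by (simp add: C_def metric_graph_def)
  have "linear_on ?V I"
    using CE unfolding linear_on_def I_def
    by (simp add: linear_on_add[OF linC] linear_on_scale[OF linC] linear_on_add[OF lin(1)] linear_on_scale[OF lin(1)])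
  moreover have "I (I u) = - u" if "u \<in> ?V" for u
  proof -
    have "C (I (I u)) = - C u"
      using sq[OF CE[OF that]] JpC[OF that] JpC[OF IV[OF that]] by simp
    from arg_cong[OF this, of fst] show ?thesis by (simp add: fstC)
  qed
  ultimately have cs: "complex_structure_on ?V I"
    using IV by (auto simp: complex_structure_on_def)
  have iso: "g p (I u) (I v) = g p u v" if "u \<in> ?V" "v \<in> ?V" for u v
  proof -
    have "s * g p (I u) (I v) = s * g p u v"
      using orth[OF CE[OF that(1)] CE[OF that(2)]] that IV
      by (simp add: JpC) (simp add: C_def pairing_metric_graph)
    with s0 show ?thesis by simp
  qed
  have JmC: "Jm p (C u) = C (s *\<^sub>R I u)" if u: "u \<in> ?V" for u
  proof -
    \<comment> \<open>Inserting the square of \<open>Jp\<close>, which is \<open>- 1\<close>,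
      produces \<open>- Jp Jm\<close>, which acts on the graph as multiplication by
      \<open>s\<close>.\<close>
    have "Jm p (C u) = Jp p (- Jp p (Jm p (C u)))"
      using CE[OF u] inE sq by (simp add: linear_on_minus[OF lin(1)])
    also have "\<dots> = s *\<^sub>R Jp p (C u)"
      using CE[OF u] by (simp add: GC[OF u] linear_on_scale[OF lin(1)])
    finally show ?thesis
      using IV[OF u] by (simp add: JpC[OF u] linear_on_scale[OF linC])
  qed
  show thesis
    using cs iso JpC JmC unfolding C_def by (rule that)
qed

end

section \<open>Lie algebraic structures at the identity\<close>

lemma lie_group_simps:
  assumes "lie_group K"
  shows "smooth_manifold K" "gmult K x (gone K) = x" "gmult K (gone K) x = x"
    "ginv K (gone K) = gone K"
proof -
  interpret group "gmult K" "gone K" "ginv K"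
    using assms by (simp add: lie_group_def)
  show "smooth_manifold K" "gmult K x (gone K) = x" "gmult K (gone K) x = x"
    "ginv K (gone K) = gone K"
    using assms by (simp_all add: lie_group_def inverse_neutral)
qed

text \<open>The cutoff in \<open>push\<close> is harmless because tangent vectors already vanish on
  functions that are not smooth near \<open>p\<close>.\<close>

lemma push_id:
  assumes "v \<in> tangent M p"
  shows "push M (\<lambda>x. x) p v = v"
  using assms by (auto simp: push_def tangent_def fun_eq_iff o_def)

text \<open>Translation by the identity element, on either side, is the identity map.\<close>

lemma
  assumes K: "lie_group K" and v: "v \<in> liek K"
  shows theta_r_gone: "theta_r K (gone K) v = v"
    and theta_l_gone: "theta_l K (gone K) v = v"
    and right_field_gone: "right_field K v (gone K) = v"
    and left_field_gone: "left_field K v (gone K) = v"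
  using push_id[of v K "gone K"] v
  by (simp_all add: theta_r_def theta_l_def right_field_def left_field_def lie_group_simps[OF K]
      liek_def)

section \<open>The form \<open>\<kappa>\<close> and the metric \<open>sigma\<close> at the
  identity\<close>

context
  fixes K :: "'k::{t2_space,second_countable_topology} lie_grp"
    and \<kappa> :: "'k cvec \<Rightarrow> 'k cvec \<Rightarrow> complex"
  assumes K: "lie_group K" and \<kappa>: "invariant_form K \<kappa>"
begin

lemma subspace_liek: "subspace (liek K)"
  unfolding liek_def by (rule subspace_tangent[OF lie_group_simps(1)[OF K]])

lemma riemannian_metric_sigma: "riemannian_metric K (sigma K \<kappa>)"
  using \<kappa> by (simp add: invariant_form_def bi_invariant_metric_def)

lemma of_re_in_lieg: "u \<in> liek K \<Longrightarrow> of_re u \<in> lieg K"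
  using subspace_liek by (simp add: lieg_def complexify_def subspace_0)

text \<open>\<open>sigma\<close> is defined as a real part, but \<open>invariant_form\<close> makes
  \<open>\<kappa>\<close> real on real vectors, so nothing is lost.\<close>

lemma kappa_of_re_of_re:
  assumes "u \<in> liek K" "v \<in> liek K"
  shows "\<kappa> (of_re u) (of_re v) = of_real (sigma K \<kappa> (gone K) u v)"
  using \<kappa> assms by (auto simp: invariant_form_def sigma_def theta_r_gone[OF K])

lemma kappa_sym: "a \<in> lieg K \<Longrightarrow> b \<in> lieg K \<Longrightarrow> \<kappa> a b = \<kappa> b a"
  using \<kappa> by (simp add: invariant_form_def)

lemma kappa_left:
  assumes a: "a \<in> lieg K" and b: "b \<in> lieg K"
  shows "\<kappa> a b = \<kappa> (of_re (re a)) b + \<i> * \<kappa> (of_re (im a)) b"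
proof -
  have "re a \<in> liek K" "im a \<in> liek K"
    using a by (simp_all add: lieg_def complexify_def)
  then have 1: "of_re (re a) \<in> lieg K" "of_re (im a) \<in> lieg K"
    by (simp_all only: of_re_in_lieg)
  then have 2: "cscale \<i> (of_re (im a)) \<in> lieg K"
    using cx.subspace_scale[OF subspace_complexify[OF subspace_liek]] by (simp add: lieg_def)
  have "\<kappa> a b = \<kappa> (of_re (re a) + cscale \<i> (of_re (im a))) b"
    by (simp flip: cplx_eq_of_re)
  also have "\<dots> = \<kappa> (of_re (re a)) b + \<kappa> (cscale \<i> (of_re (im a))) b"
    using \<kappa> 1 2 b by (simp add: invariant_form_def)
  also have "\<kappa> (cscale \<i> (of_re (im a))) b = \<i> * \<kappa> (of_re (im a)) b"
    using \<kappa> 1 b by (simp add: invariant_form_def)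
  finally show ?thesis .
qed

text \<open>\<open>invariant_form\<close> states linearity in the first argument, so
  \<open>b\<close> is moved there by symmetry; this explains the order of the arguments of
  \<open>sigma\<close>.\<close>

lemma kappa_of_re:
  assumes v: "v \<in> liek K" and b: "b \<in> lieg K"
  shows "\<kappa> (of_re v) b = Complex (sigma K \<kappa> (gone K) (re b) v) (sigma K \<kappa> (gone K) (im b) v)"
proof -
  have "re b \<in> liek K" "im b \<in> liek K"
    using b by (auto simp: lieg_def complexify_def)
  then show ?thesis
    using kappa_left[OF b of_re_in_lieg[OF v]] v
    by (simp add: kappa_sym[OF of_re_in_lieg[OF v] b] kappa_of_re_of_re complex_eq_iff)
qed

text \<open>In short, \<open>\<kappa> a b = \<kappa> (I a) (I b) = \<i> * \<i> * \<kappa> a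
  b\<close> for the complex linear extension of \<open>I\<close>. The proof writes this out for
  \<open>u - i I u\<close> and \<open>v - i I v\<close>.\<close>

lemma kappa_eigenspace_i:
  assumes I: "complex_structure_on (liek K) I"
    and iso: "\<And>u v. u \<in> liek K \<Longrightarrow> v \<in> liek K \<Longrightarrow>
      sigma K \<kappa> (gone K) (I u) (I v) = sigma K \<kappa> (gone K) u v"
    and ab: "a \<in> eigenspace_i (liek K) I" "b \<in> eigenspace_i (liek K) I"
  shows "\<kappa> a b = 0"
proof -
  let ?k = "sigma K \<kappa> (gone K)"
  note minus = metric_linear(4,5)[OF lie_group_simps(1)[OF K] riemannian_metric_sigma, of _ "gone K",
      folded liek_def]
  define u v where "u = re a" and "v = re b"
  have uv: "u \<in> liek K" "v \<in> liek K" "im a = - I u" "im b = - I v"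
    using ab by (auto simp: u_def v_def eigenspace_i_iff[OF I subspace_liek])
  note IV = complex_structure_onD[OF I]
  have ab': "a \<in> lieg K" "b \<in> lieg K"
    using ab by (auto simp: eigenspace_i_def lieg_def)
  have "\<kappa> a b = Complex (?k v u) (?k (- I v) u) + \<i> * Complex (?k v (- I u)) (?k (- I v) (- I u))"
    using uv IV(1) subspace_neg[OF subspace_liek] kappa_left[OF ab'] ab'(2)
    by (simp add: kappa_of_re flip: u_def v_def)
  also have "\<dots> = Complex (?k v u - ?k (I v) (I u)) (- (?k (I v) u + ?k v (I u)))"
    using uv IV(1) subspace_neg[OF subspace_liek] by (simp add: minus complex_eq_iff)
  \<comment> \<open>An isometry with square \<open>- 1\<close> is skew, which cancels the imaginary
    part; the real part vanishes by isometry alone.\<close>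
  also have "?k v (I u) = - ?k (I v) u"
    using iso[of v "I u"] uv IV by (simp add: minus)
  finally show ?thesis
    using uv iso by (simp add: complex_eq_iff)
qed

section \<open>Lagrangian subalgebras as products of eigenspaces\<close>

abbreviation sigma_graph :: "real \<Rightarrow> 'k tvec \<Rightarrow> 'k gvec" where
  "sigma_graph \<equiv> metric_graph K (sigma K \<kappa>) (gone K)"

text \<open>At the identity the Cartan forms are the identity, so \<open>(a, a')\<close> goes to the
  vector \<open>a' - a\<close> plus the covector dual to \<open>a' + a\<close>. The opposite signs
  of \<open>a\<close> are what places it on the graph of \<open>- sigma\<close>.\<close>

lemma courant_triv_gone:
  assumes x: "x \<in> lied K"
  shows "courant_triv K \<kappa> x (gone K) = Cplx
    (sigma_graph 1 (re (snd x)) - sigma_graph (- 1) (re (fst x)))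
    (sigma_graph 1 (im (snd x)) - sigma_graph (- 1) (im (fst x)))"
proof -
  have x': "fst x \<in> lieg K" "snd x \<in> lieg K" "re (fst x) \<in> liek K" "im (fst x) \<in> liek K"
    "re (snd x) \<in> liek K" "im (snd x) \<in> liek K"
    using x by (auto simp: lied_def lieg_def complexify_def)
  have "\<kappa> (of_re (theta_r K (gone K) v)) (snd x) = \<kappa> (of_re v) (snd x)"
    "\<kappa> (of_re (theta_l K (gone K) v)) (fst x) = \<kappa> (of_re v) (fst x)" if "v \<in> liek K" for v
    using that by (simp_all add: theta_r_gone[OF K] theta_l_gone[OF K])
  then show ?thesis
    using x' by (auto simp: courant_triv_def Let_def metric_graph_def flat_def fun_eq_iff
        right_field_gone[OF K] left_field_gone[OF K] kappa_of_re simp flip: liek_def)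
qed

text \<open>The eigenvalue equation separates along the two graphs and gives one inclusion. The
  product is isotropic, hence orthogonal to \<open>L\<close>, and a Lagrangian \<open>L\<close>
  contains everything orthogonal to it.\<close>

lemma defines_gc_eq_eigenspaces:
  assumes L: "defines_gc K \<kappa> L J"
    and A: "complex_structure_on (liek K) A"
    and isoA: "\<And>u v. u \<in> liek K \<Longrightarrow> v \<in> liek K \<Longrightarrow>
      sigma K \<kappa> (gone K) (A u) (A v) = sigma K \<kappa> (gone K) u v"
    and B: "complex_structure_on (liek K) B"
    and isoB: "\<And>u v. u \<in> liek K \<Longrightarrow> v \<in> liek K \<Longrightarrow>
      sigma K \<kappa> (gone K) (B u) (B v) = sigma K \<kappa> (gone K) u v"
    and JA: "\<And>u. u \<in> liek K \<Longrightarrow> J (gone K) (sigma_graph 1 u) = sigma_graph 1 (A u)"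
    and JB: "\<And>u. u \<in> liek K \<Longrightarrow> J (gone K) (sigma_graph (- 1) u) = sigma_graph (- 1) (B u)"
  shows "L = eigenspace_i (liek K) B \<times> eigenspace_i (liek K) A"
proof
  let ?e = "gone K"
  note setting = lie_group_simps(1)[OF K] riemannian_metric_sigma
  have lag: "L = {x \<in> lied K. \<forall>y\<in>L. lied_form \<kappa> x y = 0}" "L \<subseteq> lied K"
    and eig: "i_eigenbundle K J ?e = cx.span ((\<lambda>x. courant_triv K \<kappa> x ?e) ` L)"
    and linJ: "linear_on (gtangent K ?e) (J ?e)"
    using L by (simp_all add: defines_gc_def lagrangian_subalgebra_def gen_complex_def)
  have graph_E: "sigma_graph s u \<in> gtangent K ?e" if "u \<in> liek K" for s u
    using metric_graph_in_gtangent[OF setting] that by (simp add: liek_def)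
  have J_diff: "J ?e (sigma_graph 1 u - sigma_graph (- 1) v) = sigma_graph 1 (A u) - sigma_graph (- 1) (B v)"
    if "u \<in> liek K" "v \<in> liek K" for u v
    using that linear_on_diff[OF linJ subspace_gtangent[OF setting(1)] graph_E[OF that(1)] graph_E[OF that(2)]]
    by (simp add: JA JB)
  show "L \<subseteq> eigenspace_i (liek K) B \<times> eigenspace_i (liek K) A"
  proof
    fix x assume x: "x \<in> L"
    define a b where "a = fst x" and "b = snd x"
    have V: "re a \<in> liek K" "im a \<in> liek K" "re b \<in> liek K" "im b \<in> liek K" and xd: "x \<in> lied K"
      using x lag(2) by (auto simp: a_def b_def lied_def lieg_def complexify_def)
    have "courant_triv K \<kappa> x ?e \<in> i_eigenbundle K J ?e"
      unfolding eig using x by (intro cx.span_base) auto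
    \<comment> \<open>The real part of the equation \<open>J x = i x\<close>: \<open>J\<close> sends
      the real part of \<open>x\<close> to minus its imaginary part.\<close>
    then have "J ?e (sigma_graph 1 (re b) - sigma_graph (- 1) (re a))
        = - (sigma_graph 1 (im b) - sigma_graph (- 1) (im a))"
      unfolding courant_triv_gone[OF xd]
      by (simp add: i_eigenbundle_def cext_def cscale_def a_def b_def)
    also have "\<dots> = sigma_graph 1 (- im b) - sigma_graph (- 1) (- im a)"
      using V linear_on_minus[OF linear_on_metric_graph[OF setting], of _ ?e]
      by (simp add: liek_def)
    finally have "sigma_graph 1 (A (re b)) - sigma_graph (- 1) (B (re a))
        = sigma_graph 1 (- im b) - sigma_graph (- 1) (- im a)"
      using V by (simp add: J_diff)
    then have "A (re b) = - im b" "B (re a) = - im a"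
      using metric_graphs_independent[OF setting, of "A (re b)" ?e "B (re a)" "- im b" "- im a"]
        V complex_structure_onD(1)[OF A] complex_structure_onD(1)[OF B] subspace_neg[OF subspace_liek]
      by (auto simp: liek_def)
    with V have "a \<in> eigenspace_i (liek K) B" "b \<in> eigenspace_i (liek K) A"
      by (simp_all add: eigenspace_i_iff[OF A subspace_liek] eigenspace_i_iff[OF B subspace_liek])
    then show "x \<in> eigenspace_i (liek K) B \<times> eigenspace_i (liek K) A"
      by (simp add: a_def b_def mem_Times_iff)
  qed
  then have sub: "fst y \<in> eigenspace_i (liek K) B" "snd y \<in> eigenspace_i (liek K) A" if "y \<in> L" for y
    using that by auto
  show "eigenspace_i (liek K) B \<times> eigenspace_i (liek K) A \<subseteq> L"
  proof
    fix x assume x: "x \<in> eigenspace_i (liek K) B \<times> eigenspace_i (liek K) A"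
    \<comment> \<open>By the inclusion just shown, each of the two terms pairs elements of one and
      the same isotropic eigenspace.\<close>
    have "lied_form \<kappa> x y = 0" if "y \<in> L" for y
      using x sub[OF that] kappa_eigenspace_i[OF A isoA] kappa_eigenspace_i[OF B isoB]
      by (auto simp: lied_form_def mem_Times_iff)
    moreover have "x \<in> lied K"
      using x by (auto simp: lied_def lieg_def eigenspace_i_def)
    ultimately show "x \<in> L"
      by (subst lag(1)) simp
  qed
qed

text \<open>Dimension, transversality to \<open>k\<close> and orthogonality all come from
  \<open>I\<close>; integrability is the assumption \<open>br\<close>, to be supplied by a
  subalgebra of the double.\<close>

lemma samelson_eigenspace_i:
  assumes I: "complex_structure_on (liek K) I"
    and iso: "\<And>u v. u \<in> liek K \<Longrightarrow> v \<in> liek K \<Longrightarrow>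
      sigma K \<kappa> (gone K) (I u) (I v) = sigma K \<kappa> (gone K) u v"
    and br: "\<And>a b. a \<in> eigenspace_i (liek K) I \<Longrightarrow> b \<in> eigenspace_i (liek K) I \<Longrightarrow>
      lieg_br K a b \<in> eigenspace_i (liek K) I"
  shows "samelson K \<kappa> (eigenspace_i (liek K) I)"
proof -
  let ?l = "eigenspace_i (liek K) I"
  note iff = eigenspace_i_iff[OF I subspace_liek]
  have lin: "linear_on (liek K) I" and maps: "I ` liek K \<subseteq> liek K"
    and sq: "\<forall>a\<in>liek K. I (I a) = - a"
    using I by (auto simp: complex_structure_on_def)
  have I0: "I 0 = 0"
    using linear_on_scale[OF lin, of 0 0] subspace_0[OF subspace_liek] by simp
  obtain S where S: "finite S" "card S = mdim K" "independent S" "span S = liek K"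
    unfolding liek_def by (rule tangent_basis[OF lie_group_simps(1)[OF K]])
  have "2 * cx.dim ?l = mdim K"
    using dim_eigenspace_i[OF I S(1,3,4)] S(2) by simp
  moreover have "?l \<inter> of_re ` liek K = {0}"
  proof
    show "?l \<inter> of_re ` liek K \<subseteq> {0}"
    proof
      \<comment> \<open>A real eigenvector \<open>u\<close> has imaginary part
        \<open>- I u = 0\<close>, and \<open>I\<close> is injective.\<close>
      fix x assume "x \<in> ?l \<inter> of_re ` liek K"
      then obtain u where u: "u \<in> liek K" "x = of_re u" "I u = 0"
        by (auto simp: iff)
      with sq have "- u = I 0" by metis
      with u I0 show "x \<in> {0}" by (simp add: of_re_def zero_cplx_def)
    qed
    show "{0} \<subseteq> ?l \<inter> of_re ` liek K"
      using subspace_0[OF subspace_liek] I0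
      by (auto simp: iff zero_cplx_def of_re_def image_iff)
  qed
  moreover have "\<forall>a\<in>liek K. \<forall>b\<in>liek K. \<kappa> (of_re (I a)) (of_re (I b)) = \<kappa> (of_re a) (of_re b)"
    using maps iso by (simp add: kappa_of_re_of_re image_subset_iff)
  ultimately show ?thesis
    unfolding samelson_def
    using subspace_eigenspace_i[OF I subspace_liek] br lin maps sq
    by (auto simp: eigenspace_i_def lieg_def)
qed

end

theorem lemma5p7:
  fixes K :: "'k::{t2_space,second_countable_topology} lie_grp"
    and \<kappa> :: "'k cvec \<Rightarrow> 'k cvec \<Rightarrow> complex"
    and Jp Jm :: "'k \<Rightarrow> 'k gvec \<Rightarrow> 'k gvec"
    and Lp Lm :: "('k cvec \<times> 'k cvec) set"
  assumes "lie_group K" "compact (UNIV :: 'k set)" "connected (UNIV :: 'k set)" "even (mdim K)"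
    and "invariant_form K \<kappa>"
    and "lie_algebraic_gk K \<kappa> Jp Jm"
    and "defines_gc K \<kappa> Lp Jp" and "defines_gc K \<kappa> Lm Jm"
  shows "\<exists>lm lp. samelson K \<kappa> lm \<and> samelson K \<kappa> lp
    \<and> Lp = lm \<times> lp \<and> Lm = (conj_cplx ` lm) \<times> lp"
proof -
  note K = assms(1) and \<kappa> = assms(5)
  note setting = lie_group_simps(1)[OF K] riemannian_metric_sigma[OF K \<kappa>]
  let ?V = "liek K" and ?k = "sigma K \<kappa> (gone K)"
  let ?gr = "metric_graph K (sigma K \<kappa>) (gone K)"
  have V: "subspace ?V" by (rule subspace_liek[OF K \<kappa>])
  have gk: "gen_kahler K (cartan_three_form K \<kappa>) Jp Jm (sigma K \<kappa>)"
    using assms(6) by (simp add: lie_algebraic_gk_def)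
  obtain A where A: "complex_structure_on ?V A"
    and isoA: "\<And>u v. u \<in> ?V \<Longrightarrow> v \<in> ?V \<Longrightarrow> ?k (A u) (A v) = ?k u v"
    and JpA: "\<And>u. u \<in> ?V \<Longrightarrow> Jp (gone K) (?gr 1 u) = ?gr 1 (A u)"
    and JmA: "\<And>u. u \<in> ?V \<Longrightarrow> Jm (gone K) (?gr 1 u) = ?gr 1 (1 *\<^sub>R A u)"
    unfolding liek_def by (rule gen_kahler_metric_graph[OF setting gk, of 1 "gone K"]) auto
  obtain B where B: "complex_structure_on ?V B"
    and isoB: "\<And>u v. u \<in> ?V \<Longrightarrow> v \<in> ?V \<Longrightarrow> ?k (B u) (B v) = ?k u v"
    and JpB: "\<And>u. u \<in> ?V \<Longrightarrow> Jp (gone K) (?gr (- 1) u) = ?gr (- 1) (B u)"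
    and JmB: "\<And>u. u \<in> ?V \<Longrightarrow> Jm (gone K) (?gr (- 1) u) = ?gr (- 1) (- 1 *\<^sub>R B u)"
    unfolding liek_def by (rule gen_kahler_metric_graph[OF setting gk, of "- 1" "gone K"]) auto
  let ?lm = "eigenspace_i ?V B" and ?lp = "eigenspace_i ?V A"
  \<comment> \<open>On the graph of \<open>- sigma\<close>, \<open>Jm\<close> acts by
    \<open>- B\<close>, which must again be an isometry.\<close>
  have isoB': "?k (- B u) (- B v) = ?k u v" if "u \<in> ?V" "v \<in> ?V" for u v
  proof -
    note minus = metric_linear(4,5)[OF setting, of _ "gone K", folded liek_def]
    have "B u \<in> ?V" "B v \<in> ?V" "- B v \<in> ?V"
      using that complex_structure_onD(1)[OF B] V by (simp_all add: subspace_neg)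
    then show ?thesis
      using isoB[OF that] by (simp add: minus)
  qed
  have Lp: "Lp = ?lm \<times> ?lp"
    by (rule defines_gc_eq_eigenspaces[OF K \<kappa> assms(7) A isoA B isoB JpA JpB])
  \<comment> \<open>\<open>A\<close> is shared by \<open>Jp\<close> and \<open>Jm\<close>, hence so
    is the second factor; in the first factor \<open>B\<close> changes sign.\<close>
  have "Lm = eigenspace_i ?V (\<lambda>u. - B u) \<times> ?lp"
    using JmA JmB
    by (intro defines_gc_eq_eigenspaces[OF K \<kappa> assms(8) A isoA complex_structure_on_uminus[OF B V] isoB'])
      simp_all
  then have Lm: "Lm = (conj_cplx ` ?lm) \<times> ?lp"
    by (simp add: conj_cplx_eigenspace_i[OF B V])
  \<comment> \<open>\<open>Lp\<close> is closed under the componentwise bracket. Pairs with one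
    entry 0 then show that each factor is a subalgebra.\<close>
  have br: "lied_br K x y \<in> ?lm \<times> ?lp" if "x \<in> ?lm \<times> ?lp" "y \<in> ?lm \<times> ?lp" for x y
    using assms(7) that unfolding defines_gc_def lagrangian_subalgebra_def Lp by blast
  have 0: "0 \<in> ?lm" "0 \<in> ?lp"
    by (rule cx.subspace_0[OF subspace_eigenspace_i] A B V)+
  have "samelson K \<kappa> ?lm"
    using br[of "(_, 0)" "(_, 0)"] 0
    by (intro samelson_eigenspace_i K \<kappa> B isoB) (auto simp: lied_br_def)
  moreover have "samelson K \<kappa> ?lp"
    using br[of "(0, _)" "(0, _)"] 0
    by (intro samelson_eigenspace_i K \<kappa> A isoA) (auto simp: lied_br_def)
  ultimately show ?thesis
    using Lp Lm by blast
qed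

end
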